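(* Let $p\geq 3$ be prime and $t\geq 3$. Let $\mathcal{A}_{t,p}$ be the number of nonequivalent $\mathbb{Z}_{p^s}$-linear GH codes of length $p^t$ (over all $s\geq1$), and $\mathcal{A}_{t,s,p}$ the number of nonequivalent $\mathbb{Z}_{p^s}$-linear GH codes of length $p^t$ for fixed $s$. For $s\geq 2$ let $\tilde{X}_{t,s,p}=|\{(t_1,\dots,t_s)\in\mathbb{N}^s: t+1=\sum_{i=1}^s(s-i+1)t_i,\ t_1\geq 2\}|$. Then $$\mathcal{A}_{t,p}\leq 1+\sum_{s=2}^{\lfloor (t+1)/2\rfloor}\tilde{X}_{t,s,p}\quad\text{and}\quad \mathcal{A}_{t,p}\leq 1+\sum_{s=2}^{\lfloor (t+1)/2\rfloor}(\mathcal{A}_{t,s,p}-1).$$ Moreover, for $3\leq t\leq 10$ the first upper bound is tight, i.e. $\mathcal{A}_{t,p}=1+\sum_{s=2}^{\lfloor (t+1)/2\rfloor}\tilde{X}_{t,s,p}$.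
   Context: For $s\geq 1$ and $u\in\mathbb{Z}_{p^s}$ with $p$-ary expansion $u=\sum_{i=0}^{s-1}u_ip^i$, $u_i\in\{0,\dots,p-1\}$, the Gray map $\phi_s:\mathbb{Z}_{p^s}\to\mathbb{Z}_p^{p^{s-1}}$ is $\phi_s(u)=(u_{s-1},\dots,u_{s-1})+(u_0,\dots,u_{s-2})Y_{s-1}$, where $Y_{s-1}$ is an $(s-1)\times p^{s-1}$ matrix whose columns are exactly the elements of $\mathbb{Z}_p^{s-1}$; $\phi_1$ is the identity. $\Phi_s$ applies $\phi_s$ coordinatewise and concatenates. For $1\le i\le s$ let $T_i=\{jp^{i-1}: 0\le j\le p^{s-i+1}-1\}\subseteq\mathbb{Z}_{p^s}$. For nonnegative integers $t_1\geq1,t_2,\dots,t_s$, $A^{t_1,\dots,t_s}$ is the matrix over $\mathbb{Z}_{p^s}$ whose columns are all vectors $\mathbf{z}^T$ with $\mathbf{z}\in\{1\}\times T_1^{t_1-1}\times T_2^{t_2}\times\cdots\times T_s^{t_s}$; $\mathcal{H}^{t_1,\dots,t_s}$ is the subgroup generated by its rows and $H^{t_1,\dots,t_s}=\Phi_s(\mathcal{H}^{t_1,\dots,t_s})$ is the $\mathbb{Z}_{p^s}$-linear GH code; it has length $p^t$ where $t=\sum_{i=1}^s(s-i+1)t_i-1$. The $\mathbb{Z}_{p^s}$-linear GH codes of length $p^t$ are the codes $H^{t_1,\dots,t_s}$ with this value of $t$. Two codes $C_1,C_2\subseteq\mathbb{Z}_p^N$ are equivalent if $C_2=\{\mathbf{a}+\pi(\mathbf{c}):\mathbf{c}\in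 C_1\}$ for some $\mathbf{a}\in\mathbb{Z}_p^N$ and coordinate permutation $\pi$. *)

theory Defs
  imports "HOL-Combinatorics.Permutations" "HOL-Computational_Algebra.Primes"
begin

(* Elements of Z_{p^s} are represented by naturals u < p^s; elements of Z_p by naturals < p.
   Vectors are lists. *)

definition digit :: "nat \<Rightarrow> nat \<Rightarrow> nat \<Rightarrow> nat" where
  "digit p k u = (u div p ^ k) mod p"

(* Gray map phi_s : Z_{p^s} -> Z_p^{p^{s-1}}.  The matrix Y_{s-1} has as column j
   (0 <= j < p^{s-1}) the p-ary expansion (digit p 0 j, ..., digit p (s-2) j) of j,
   so its columns are exactly the elements of Z_p^{s-1}. *)
definition gray :: "nat \<Rightarrow> nat \<Rightarrow> nat \<Rightarrow> nat list" where
  "gray p s u = map (\<lambda>j. (digit p (s - 1) u + (\<Sum>k<s - 1. digit p k u * digit p k j)) mod p)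
                    [0..<p ^ (s - 1)]"

definition Gray :: "nat \<Rightarrow> nat \<Rightarrow> nat list \<Rightarrow> nat list" where
  "Gray p s v = concat (map (gray p s) v)"

definition Tset :: "nat \<Rightarrow> nat \<Rightarrow> nat \<Rightarrow> nat list" where
  "Tset p s i = map (\<lambda>j. j * p ^ (i - 1)) [0..<p ^ (s - i + 1)]"

fun listprod :: "nat list list \<Rightarrow> nat list list" where
  "listprod [] = [[]]"
| "listprod (S # Ss) = concat (map (\<lambda>x. map (\<lambda>z. x # z) (listprod Ss)) S)"

definition factors :: "nat \<Rightarrow> nat list \<Rightarrow> nat list list" where
  "factors p ts = (let s = length ts in
     [[1]] @ replicate (ts ! 0 - 1) (Tset p s 1)
       @ concat (map (\<lambda>i. replicate (ts ! (i - 1)) (Tset p s i)) [2..<s + 1]))"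

definition colsA :: "nat \<Rightarrow> nat list \<Rightarrow> nat list list" where
  "colsA p ts = listprod (factors p ts)"

(* the Z_{p^s}-linear code calH^{t_1,...,t_s}: subgroup of Z_{p^s}^n generated by the
   rows of A, i.e. all combinations sum_i lambda_i row_i (lambda_i natural), mod p^s *)
definition calH :: "nat \<Rightarrow> nat list \<Rightarrow> nat list set" where
  "calH p ts = {map (\<lambda>z. (\<Sum>i<length z. lam i * z ! i) mod p ^ length ts) (colsA p ts)
                 | lam. True}"

definition GH :: "nat \<Rightarrow> nat list \<Rightarrow> nat list set" where
  "GH p ts = Gray p (length ts) ` calH p ts"

definition tval :: "nat list \<Rightarrow> nat" where
  "tval ts = (\<Sum>i<length ts. (length ts - i) * ts ! i) - 1"

definition admissible :: "nat list \<Rightarrow> bool" where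
  "admissible ts \<longleftrightarrow> length ts \<ge> 1 \<and> ts ! 0 \<ge> 1"

definition code_equiv :: "nat \<Rightarrow> nat \<Rightarrow> nat list set \<Rightarrow> nat list set \<Rightarrow> bool" where
  "code_equiv p N C1 C2 \<longleftrightarrow>
     (\<exists>a \<pi>. length a = N \<and> set a \<subseteq> {..<p} \<and> \<pi> permutes {..<N} \<and>
        C2 = (\<lambda>c. map (\<lambda>j. (a ! j + c ! \<pi> j) mod p) [0..<N]) ` C1)"

definition GHcodes_s :: "nat \<Rightarrow> nat \<Rightarrow> nat \<Rightarrow> nat list set set" where
  "GHcodes_s p t s = {GH p ts | ts. admissible ts \<and> length ts = s \<and> tval ts = t}"

definition GHcodes :: "nat \<Rightarrow> nat \<Rightarrow> nat list set set" where
  "GHcodes p t = {GH p ts | ts. admissible ts \<and> tval ts = t}"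

definition num_noneq :: "nat \<Rightarrow> nat \<Rightarrow> nat list set set \<Rightarrow> nat" where
  "num_noneq p N S = card (S // {(C1, C2). C1 \<in> S \<and> C2 \<in> S \<and> code_equiv p N C1 C2})"

definition A_tp :: "nat \<Rightarrow> nat \<Rightarrow> nat" where
  "A_tp t p = num_noneq p (p ^ t) (GHcodes p t)"

definition A_tsp :: "nat \<Rightarrow> nat \<Rightarrow> nat \<Rightarrow> nat" where
  "A_tsp t s p = num_noneq p (p ^ t) (GHcodes_s p t s)"

definition Xtilde :: "nat \<Rightarrow> nat \<Rightarrow> nat \<Rightarrow> nat" where
  "Xtilde t s p = card {ts :: nat list. length ts = s \<and>
       t + 1 = (\<Sum>i<s. (s - i) * ts ! i) \<and> ts ! 0 \<ge> 2}"

end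

theory Submission
  imports Defs "HOL-Number_Theory.Cong" "HOL-Library.FuncSet" "HOL-Library.Multiset"
begin

text \<open>Call a vector \<open>v\<close> with \<open>v + C \<subseteq> C\<close> a period of the code \<open>C\<close>. For \<open>t\<^sub>1 \<ge> 2\<close> (or \<open>s = 1\<close>) and \<open>p \<ge> 3\<close> the
  periods are the Gray images of the elements of order dividing \<open>p\<close>, so two coordinates have the same
  value in every period iff their columns \<open>z\<close>, each entry in \<open>T\<^sub>i\<close> being divided by \<open>p ^ (i - 1)\<close>, agree modulo \<open>p\<close>. Restricting the code to
  one class of coordinates that the periods do not separate gives the code of type
  \<open>(1, t\<^sub>1 - 1, t\<^sub>2, \<dots>, t\<^bsub>s-1\<^esub>)\<close>, which up to a permutation of coordinates is the code of type
  \<open>(t\<^sub>1, \<dots>, t\<^bsub>s-2\<^esub>, t\<^bsub>s-1\<^esub> + 1)\<close>. Since periods are invariant under equivalence, induction on \<open>s\<close>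
  recovers the type: codes with \<open>t\<^sub>1 \<ge> 2\<close> of different types are never equivalent. As the same
  permutation reduces every code with \<open>t\<^sub>1 = 1\<close> to one with \<open>s = 1\<close> or \<open>t\<^sub>1 \<ge> 2\<close>, the first bound is an
  equality for every \<open>t\<close>. The second bound follows, because for each \<open>s\<close> the type
  \<open>(1, 0, \<dots>, 0, t + 1 - s)\<close> is linear and contributes one further class.\<close>

section \<open>Digits\<close>

lemma digit_add_power_lower:
  assumes "p > 0" "k < n"
  shows "digit p k (g + p ^ n * c) = digit p k g"
proof -
  obtain d where n: "n = k + Suc d" using assms(2) less_iff_Suc_add by auto
  have "g + p ^ n * c = g + p ^ k * (p * (p ^ d * c))" by (simp add: n power_add mult.assoc)
  then have "(g + p ^ n * c) div p ^ k = g div p ^ k + p * (p ^ d * c)"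
    using assms(1) by (metis add.commute div_mult_self4 less_numeral_extra(3) power_not_zero)
  then show ?thesis by (simp add: digit_def)
qed

lemma digit_add_power_same:
  assumes "p > 0"
  shows "[digit p n (g + p ^ n * c) = digit p n g + c] (mod p)"
  using assms by (simp add: digit_def cong_def mod_simps add.commute)

lemma digit_mod_power:
  assumes "p > 0" "k < s"
  shows "digit p k (u mod p ^ s) = digit p k u"
  using digit_add_power_lower[OF assms, of "u mod p ^ s" "u div p ^ s"] by simp

lemma digit_cong:
  assumes "p > 0" "k < s" "[u = v] (mod p ^ s)"
  shows "digit p k u = digit p k v"
  using digit_mod_power[OF assms(1,2), of u] digit_mod_power[OF assms(1,2), of v] assms(3)
  by (simp add: cong_def)

lemma digit_Suc: "r < p \<Longrightarrow> digit p (Suc k) (r + p * g) = digit p k g"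
  by (simp add: digit_def div_mult2_eq)

lemma digit_0: "digit p 0 u = u mod p"
  by (simp add: digit_def)

lemma digit_less: "p > 0 \<Longrightarrow> digit p k u < p"
  by (simp add: digit_def)

lemma digit_of_0 [simp]: "digit p k 0 = 0"
  by (simp add: digit_def)

lemma digit_power:
  assumes "p > 1"
  shows "digit p k (p ^ m) = (if k = m then 1 else 0)"
proof (cases k m rule: linorder_cases)
  case less
  then show ?thesis using digit_add_power_lower[of p k m 0 1] assms by simp
next
  case equal
  then show ?thesis using assms by (simp add: digit_def)
next
  case greater
  then have "p ^ m < p ^ k" using assms by simp
  then show ?thesis using greater by (simp add: digit_def)
qed

lemma mod_power_Suc_digit: "n mod p ^ Suc k = n mod p ^ k + p ^ k * digit p k (n :: nat)"
  by (metis digit_def mod_mult2_eq power_Suc2 add.commute)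

text \<open>Below position \<open>m\<close> the number \<open>h\<close> has only zero digits, so the
  first carry that a digitwise sum can lose is the one from position \<open>m\<close> to
  \<open>m + 1\<close>. Whatever leaves position \<open>m + 1\<close> vanishes modulo
  \<open>p ^ (m + 2)\<close>.\<close>

lemma digit_sum_cong:
  assumes p: "p > 0" and h: "p ^ m dvd h"
    and A: "\<And>k. k < m + 2 \<Longrightarrow> digit p k A = (digit p k f + digit p k h) mod p"
  shows "[A + p ^ Suc m * (if digit p m f + digit p m h < p then 0 else 1) = f + h] (mod p ^ (m + 2))"
proof -
  have dh: "digit p k h = 0" if "k < m" for k
    using digit_cong[OF p that, of h 0] h by (simp add: cong_0_iff)
  have *: "k \<le> m \<Longrightarrow> A mod p ^ k = f mod p ^ k" for k
  proof (induction k)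
    case (Suc k)
    then show ?case
      using A[of k] dh[of k] digit_less[OF p, of k f]
      by (simp add: mod_power_Suc_digit del: power_Suc)
  qed simp
  define c :: nat where "c = (if digit p m f + digit p m h < p then 0 else 1)"
  have c: "digit p m f + digit p m h = digit p m A + p * c"
    using A[of m] digit_less[OF p, of m f] digit_less[OF p, of m h]
    by (auto simp: c_def mod_if)
  have ex: "n mod p ^ (m + 2) = n mod p ^ m + p ^ m * digit p m n + p ^ Suc m * digit p (Suc m) n" for n
    using mod_power_Suc_digit[of n p "Suc m"] mod_power_Suc_digit[of n p m] by simp
  have hm: "h mod p ^ m = 0" using h by simp
  have A1: "[digit p (Suc m) A = digit p (Suc m) f + digit p (Suc m) h] (mod p)"
    using A[of "Suc m"] by (simp add: cong_def)
  have pp: "p ^ (m + 2) = p ^ Suc m * p" by simp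
  have A2: "[p ^ Suc m * digit p (Suc m) A = p ^ Suc m * (digit p (Suc m) f + digit p (Suc m) h)] (mod p ^ (m + 2))"
    unfolding pp cong_def using A1[unfolded cong_def]
    by (metis mult_mod_right)
  have "[A + p ^ Suc m * c = A mod p ^ (m + 2) + p ^ Suc m * c] (mod p ^ (m + 2))"
    by (simp add: cong_def mod_simps)
  also have "A mod p ^ (m + 2) + p ^ Suc m * c
      = f mod p ^ m + p ^ m * (digit p m A + p * c) + p ^ Suc m * digit p (Suc m) A"
    unfolding ex using *[of m] by (simp add: algebra_simps)
  also have "\<dots> = f mod p ^ m + p ^ m * (digit p m f + digit p m h) + p ^ Suc m * digit p (Suc m) A"
    using c by simp
  also have "[\<dots> = f mod p ^ m + p ^ m * (digit p m f + digit p m h)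
      + p ^ Suc m * (digit p (Suc m) f + digit p (Suc m) h)] (mod p ^ (m + 2))"
    by (intro cong_add cong_refl A2)
  also have "f mod p ^ m + p ^ m * (digit p m f + digit p m h)
      + p ^ Suc m * (digit p (Suc m) f + digit p (Suc m) h) = f mod p ^ (m + 2) + h mod p ^ (m + 2)"
    unfolding ex using hm by (simp add: algebra_simps)
  also have "[\<dots> = f + h] (mod p ^ (m + 2))"
    by (simp add: cong_def mod_simps)
  finally show ?thesis unfolding c_def .
qed

text \<open>After division by \<open>M\<close>, two of the three values at 0, 1, 2 agree by
  pigeonhole. Their difference is the slope times 1 or 2, both units modulo
  \<open>p \<ge> 3\<close>, so the slope vanishes modulo \<open>p\<close>.\<close>

lemma affine_indicator_const:
  fixes \<delta> :: "nat \<Rightarrow> int" and a b M :: int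
  assumes p: "prime p" "p \<ge> 3" and M: "M \<noteq> 0"
    and \<delta>: "\<And>t. t < p \<Longrightarrow> \<delta> t \<in> {0, 1}"
    and c: "\<And>t. t < p \<Longrightarrow> [M * \<delta> t = a + b * int t] (mod M * int p)"
    and t: "t < p" "t' < p"
  shows "\<delta> t = \<delta> t'"
proof -
  have pi: "prime (int p)" using p by simp
  have n1: "\<not> int p dvd 1" "\<not> int p dvd 2"
    using p(2) by (auto dest!: zdvd_imp_le)
  have diff: "M * int p dvd M * (\<delta> i - \<delta> j) - b * (int i - int j)" if "i < p" "j < p" for i j
    using cong_diff[OF c[OF that(1)] c[OF that(2)]]
    by (simp add: cong_iff_dvd_diff algebra_simps)
  have Mb: "M dvd b"
  proof -
    have "M dvd M * (\<delta> 1 - \<delta> 0) - b"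
      using diff[of 1 0] p(2) by (auto dest: dvd_mult_left)
    then show ?thesis using dvd_diff[of M "M * (\<delta> 1 - \<delta> 0)" "M * (\<delta> 1 - \<delta> 0) - b"] by simp
  qed
  then obtain b' where b: "b = M * b'" by blast
  have diff': "int p dvd (\<delta> i - \<delta> j) - b' * (int i - int j)" if "i < p" "j < p" for i j
  proof -
    have "M * int p dvd M * ((\<delta> i - \<delta> j) - b' * (int i - int j))"
      using diff[OF that] by (simp add: b algebra_simps)
    then show ?thesis using M by simp
  qed
  have "\<delta> 0 = \<delta> 1 \<or> \<delta> 1 = \<delta> 2 \<or> \<delta> 0 = \<delta> 2"
    using \<delta>[of 0] \<delta>[of 1] \<delta>[of 2] p(2) by auto
  then have "int p dvd b'"
    using diff'[of 1 0] diff'[of 2 1] diff'[of 2 0] p(2) n1 pi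
    by (auto simp: prime_dvd_mult_iff)
  then have "int p dvd \<delta> t - \<delta> t'"
    using dvd_add[OF diff'[OF t] dvd_mult2[of "int p" b' "int t - int t'"]] by simp
  moreover have "\<bar>\<delta> t - \<delta> t'\<bar> \<le> 1" using \<delta>[OF t(1)] \<delta>[OF t(2)] by auto
  ultimately have "\<delta> t - \<delta> t' = 0"
    using p(2) dvd_imp_le_int[of "\<delta> t - \<delta> t'" "int p"] by fastforce
  then show ?thesis by simp
qed

text \<open>The carry out of position \<open>m\<close> is the obstruction to the digitwise sum of two affine
  functions being affine: as an affine function modulo \<open>p \<ge> 3\<close> with values in \<open>{0, 1}\<close> it would
  have to be constant.\<close>

lemma carry_const:
  assumes p: "prime p" "p \<ge> 3"
    and h: "\<And>t. t < p \<Longrightarrow> p ^ m dvd c + d * t"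
    and A: "\<And>k t. k < m + 2 \<Longrightarrow> t < p \<Longrightarrow>
      digit p k (\<alpha> + \<beta> * t) = (digit p k (a + b * t) + digit p k (c + d * t)) mod p"
    and t: "t < p" "t' < p"
  shows "digit p m (a + b * t) + digit p m (c + d * t) < p \<longleftrightarrow>
         digit p m (a + b * t') + digit p m (c + d * t') < p"
proof -
  define \<delta> :: "nat \<Rightarrow> nat" where
    "\<delta> t = (if digit p m (a + b * t) + digit p m (c + d * t) < p then 0 else 1)" for t
  have p0: "p > 0" using p by simp
  have *: "[int p ^ Suc m * int (\<delta> t) = (int a + int c - int \<alpha>) + (int b + int d - int \<beta>) * int t]
      (mod int p ^ Suc m * int p)" if "t < p" for t
  proof -
    have "[\<alpha> + \<beta> * t + p ^ Suc m * \<delta> t = a + b * t + (c + d * t)] (mod p ^ (m + 2))"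
      unfolding \<delta>_def by (rule digit_sum_cong[OF p0 h[OF that] A[OF _ that]])
    then have "[int (\<alpha> + \<beta> * t + p ^ Suc m * \<delta> t) = int (a + b * t + (c + d * t))] (mod int (p ^ (m + 2)))"
      by (simp only: cong_int_iff)
    then show ?thesis by (simp add: cong_iff_dvd_diff algebra_simps)
  qed
  have "int (\<delta> t) = int (\<delta> t')"
    by (rule affine_indicator_const[OF p _ _ * t]) (use p in \<open>auto simp: \<delta>_def\<close>)
  then show ?thesis by (auto simp: \<delta>_def split: if_splits)
qed

section \<open>Codes over arbitrary index sets\<close>

text \<open>Codewords are total functions with unreduced values, of which only the residues modulo
  \<open>p\<close> on the index set matter. Hence two existence statements take the place of an
  equality of images. As in \<open>code_equiv\<close>, \<open>\<pi>\<close> leads from target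
  coordinates to source coordinates.\<close>

definition cequiv_via ::
  "nat \<Rightarrow> ('b \<Rightarrow> 'a) \<Rightarrow> ('b \<Rightarrow> nat) \<Rightarrow> 'a set \<Rightarrow> ('a \<Rightarrow> nat) set \<Rightarrow> 'b set \<Rightarrow> ('b \<Rightarrow> nat) set \<Rightarrow> bool"
  where "cequiv_via p \<pi> a X C Y D \<longleftrightarrow> bij_betw \<pi> Y X
    \<and> (\<forall>c\<in>C. \<exists>d\<in>D. \<forall>j\<in>Y. [d j = a j + c (\<pi> j)] (mod p))
    \<and> (\<forall>d\<in>D. \<exists>c\<in>C. \<forall>j\<in>Y. [d j = a j + c (\<pi> j)] (mod p))"

definition cequiv ::
  "nat \<Rightarrow> 'a set \<Rightarrow> ('a \<Rightarrow> nat) set \<Rightarrow> 'b set \<Rightarrow> ('b \<Rightarrow> nat) set \<Rightarrow> bool"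
  where "cequiv p X C Y D \<longleftrightarrow> (\<exists>\<pi> a. cequiv_via p \<pi> a X C Y D)"

lemma cequivI_bij:
  assumes "bij_betw \<pi> Y X"
    and "\<And>c. c \<in> C \<Longrightarrow> \<exists>d\<in>D. \<forall>j\<in>Y. [d j = c (\<pi> j)] (mod p)"
    and "\<And>d. d \<in> D \<Longrightarrow> \<exists>c\<in>C. \<forall>j\<in>Y. [d j = c (\<pi> j)] (mod p)"
  shows "cequiv p X C Y D"
  unfolding cequiv_def cequiv_via_def
  by (rule exI[of _ \<pi>], rule exI[of _ "\<lambda>_. 0"]) (use assms in auto)

lemma cequiv_refl: "cequiv p X C X C"
  by (rule cequivI_bij[where \<pi> = id]) (auto intro: cong_refl)

lemma cequiv_via_sym:
  assumes p: "p > 0" and e: "cequiv_via p \<pi> a X C Y D"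
  shows "cequiv_via p (inv_into Y \<pi>) (\<lambda>i. (p - 1) * a (inv_into Y \<pi> i)) Y D X C"
proof -
  let ?\<rho> = "inv_into Y \<pi>"
  have b: "bij_betw \<pi> Y X" using e by (simp add: cequiv_via_def)
  have \<rho>: "?\<rho> i \<in> Y \<and> \<pi> (?\<rho> i) = i" if "i \<in> X" for i
    using b that by (metis bij_betw_def f_inv_into_f inv_into_into)
  \<comment> \<open>On naturals \<open>(p - 1) * a\<close> stands for the negative of
    \<open>a\<close> modulo \<open>p\<close>.\<close>
  have *: "[c i = (p - 1) * a (?\<rho> i) + d (?\<rho> i)] (mod p)"
    if d: "\<forall>j\<in>Y. [d j = a j + c (\<pi> j)] (mod p)" and i: "i \<in> X" for c d i
  proof -
    have "[(p - 1) * a (?\<rho> i) + d (?\<rho> i) = (p - 1) * a (?\<rho> i) + (a (?\<rho> i) + c i)] (mod p)"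
      using d \<rho>[OF i] by (metis cong_add_lcancel_nat)
    also have "(p - 1) * a (?\<rho> i) + (a (?\<rho> i) + c i) = p * a (?\<rho> i) + c i"
      using p by (cases p) auto
    also have "[\<dots> = c i] (mod p)" by (simp add: cong_def)
    finally show ?thesis by (rule cong_sym)
  qed
  show ?thesis
    unfolding cequiv_via_def
    using bij_betw_inv_into[OF b] * e[unfolded cequiv_via_def] by meson
qed

lemma cequiv_sym: "p > 0 \<Longrightarrow> cequiv p X C Y D \<Longrightarrow> cequiv p Y D X C"
  unfolding cequiv_def using cequiv_via_sym by blast

lemma cequiv_trans:
  assumes "cequiv p X C Y D" "cequiv p Y D Z E"
  shows "cequiv p X C Z E"
proof -
  obtain \<pi> a where 1: "cequiv_via p \<pi> a X C Y D" using assms(1) by (auto simp: cequiv_def)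
  obtain \<rho> b where 2: "cequiv_via p \<rho> b Y D Z E" using assms(2) by (auto simp: cequiv_def)
  have \<rho>: "\<rho> j \<in> Y" if "j \<in> Z" for j
    using 2 that by (auto simp: cequiv_via_def bij_betw_def)
  have *: "\<forall>j\<in>Z. [e j = (b j + a (\<rho> j)) + c ((\<pi> \<circ> \<rho>) j)] (mod p)"
    if d: "\<forall>j\<in>Y. [d j = a j + c (\<pi> j)] (mod p)" and e: "\<forall>j\<in>Z. [e j = b j + d (\<rho> j)] (mod p)"
    for c d e
  proof
    fix j assume j: "j \<in> Z"
    have "[b j + d (\<rho> j) = b j + (a (\<rho> j) + c (\<pi> (\<rho> j)))] (mod p)"
      using d \<rho>[OF j] by (metis cong_add_lcancel_nat)
    then show "[e j = (b j + a (\<rho> j)) + c ((\<pi> \<circ> \<rho>) j)] (mod p)"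
      using e j by (metis (no_types, lifting) add.assoc comp_apply cong_trans)
  qed
  have "cequiv_via p (\<pi> \<circ> \<rho>) (\<lambda>j. b j + a (\<rho> j)) X C Z E"
    unfolding cequiv_via_def
  proof (intro conjI ballI)
    show "bij_betw (\<pi> \<circ> \<rho>) Z X"
      using 1 2 bij_betw_trans by (auto simp: cequiv_via_def)
    fix c assume "c \<in> C"
    then obtain d where "d \<in> D" "\<forall>j\<in>Y. [d j = a j + c (\<pi> j)] (mod p)"
      using 1 by (auto simp: cequiv_via_def)
    moreover from this(1) obtain e where "e \<in> E" "\<forall>j\<in>Z. [e j = b j + d (\<rho> j)] (mod p)"
      using 2 by (auto simp: cequiv_via_def)
    ultimately show "\<exists>e\<in>E. \<forall>j\<in>Z. [e j = (b j + a (\<rho> j)) + c ((\<pi> \<circ> \<rho>) j)] (mod p)"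
      using * by blast
  next
    fix e assume "e \<in> E"
    then obtain d where "d \<in> D" "\<forall>j\<in>Z. [e j = b j + d (\<rho> j)] (mod p)"
      using 2 by (auto simp: cequiv_via_def)
    moreover from this(1) obtain c where "c \<in> C" "\<forall>j\<in>Y. [d j = a j + c (\<pi> j)] (mod p)"
      using 1 by (auto simp: cequiv_via_def)
    ultimately show "\<exists>c\<in>C. \<forall>j\<in>Z. [e j = (b j + a (\<rho> j)) + c ((\<pi> \<circ> \<rho>) j)] (mod p)"
      using * by blast
  qed
  then show ?thesis by (auto simp: cequiv_def)
qed

section \<open>Periods as invariants of equivalence\<close>

definition period :: "nat \<Rightarrow> 'a set \<Rightarrow> ('a \<Rightarrow> nat) set \<Rightarrow> ('a \<Rightarrow> nat) \<Rightarrow> bool" where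
  "period p X C v \<longleftrightarrow> (\<forall>c\<in>C. \<exists>d\<in>C. \<forall>x\<in>X. [d x = c x + v x] (mod p))"

definition indist :: "nat \<Rightarrow> 'a set \<Rightarrow> ('a \<Rightarrow> nat) set \<Rightarrow> 'a \<Rightarrow> 'a \<Rightarrow> bool" where
  "indist p X C a b \<longleftrightarrow> (\<forall>v. period p X C v \<longrightarrow> [v a = v b] (mod p))"

text \<open>Adding \<open>v \<circ> \<pi>\<close> to \<open>a + c \<circ> \<pi>\<close> gives the
  image of the word \<open>c + v\<close>, so the translation does no harm.\<close>

lemma cequiv_via_period:
  assumes e: "cequiv_via p \<pi> a X C Y D" and v: "period p X C v"
  shows "period p Y D (v \<circ> \<pi>)"
  unfolding period_def
proof
  fix d assume "d \<in> D"
  then obtain c where c: "c \<in> C" "\<forall>j\<in>Y. [d j = a j + c (\<pi> j)] (mod p)"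
    using e by (auto simp: cequiv_via_def)
  obtain c' where c': "c' \<in> C" "\<forall>x\<in>X. [c' x = c x + v x] (mod p)"
    using v c(1) by (auto simp: period_def)
  obtain d' where d': "d' \<in> D" "\<forall>j\<in>Y. [d' j = a j + c' (\<pi> j)] (mod p)"
    using e c'(1) by (auto simp: cequiv_via_def)
  have "[d' j = d j + (v \<circ> \<pi>) j] (mod p)" if j: "j \<in> Y" for j
  proof -
    have "\<pi> j \<in> X" using e j by (auto simp: cequiv_via_def bij_betw_def)
    then have "[a j + c' (\<pi> j) = a j + (c (\<pi> j) + v (\<pi> j))] (mod p)"
      using c'(2) by (metis cong_add_lcancel_nat)
    moreover have "[d j + v (\<pi> j) = a j + c (\<pi> j) + v (\<pi> j)] (mod p)"
      using c(2) j by (metis cong_add_rcancel_nat)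
    ultimately show ?thesis
      using d'(2) j by (metis (no_types, lifting) add.assoc comp_apply cong_sym cong_trans)
  qed
  then show "\<exists>d'\<in>D. \<forall>x\<in>Y. [d' x = d x + (v \<circ> \<pi>) x] (mod p)" using d'(1) by blast
qed

lemma cequiv_via_indist:
  assumes p: "p > 0" and e: "cequiv_via p \<pi> \<alpha> X C Y D" and ab: "a \<in> Y" "b \<in> Y"
  shows "indist p Y D a b \<longleftrightarrow> indist p X C (\<pi> a) (\<pi> b)"
proof
  assume "indist p Y D a b"
  then show "indist p X C (\<pi> a) (\<pi> b)"
    using cequiv_via_period[OF e] by (fastforce simp: indist_def)
next
  have inj: "inj_on \<pi> Y" using e by (simp add: cequiv_via_def bij_betw_def)
  assume "indist p X C (\<pi> a) (\<pi> b)"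
  then show "indist p Y D a b"
    using cequiv_via_period[OF cequiv_via_sym[OF p e]] ab inj
    by (fastforce simp: indist_def)
qed

text \<open>An equivalence matches the classes of coordinates that periods cannot separate, so it
  restricts to matched classes. This supplies the smaller codes of the induction.\<close>

lemma cequiv_via_fibre:
  assumes p: "p > 0" and e: "cequiv_via p \<pi> \<alpha> X C Y D" and b: "b \<in> Y"
  shows "cequiv p {x \<in> X. indist p X C (\<pi> b) x} C {y \<in> Y. indist p Y D b y} D"
proof -
  have bij: "bij_betw \<pi> Y X" using e by (simp add: cequiv_via_def)
  have "bij_betw \<pi> {y \<in> Y. indist p Y D b y} {x \<in> X. indist p X C (\<pi> b) x}"
    using bij cequiv_via_indist[OF p e b]
    by (auto simp: bij_betw_def inj_on_def image_iff)
  then have "cequiv_via p \<pi> \<alpha> {x \<in> X. indist p X C (\<pi> b) x} C {y \<in> Y. indist p Y D b y} D"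
    using e by (auto simp: cequiv_via_def) blast+
  then show ?thesis by (auto simp: cequiv_def)
qed

section \<open>Coordinate-free model of the codes\<close>

text \<open>Reduction modulo \<open>p\<close> is left out, since equivalence is tested by
  congruences only.\<close>

definition gray_eval :: "nat \<Rightarrow> nat \<Rightarrow> nat \<Rightarrow> nat \<Rightarrow> nat" where
  "gray_eval p s u j = digit p (s - 1) u + (\<Sum>k<s - 1. digit p k u * digit p k j)"

text \<open>The entry at column \<open>x\<close> of a combination of rows, before reduction modulo
  \<open>p ^ s\<close>; \<open>a\<close> is the coefficient of the row of ones.\<close>

definition aff :: "nat \<Rightarrow> nat \<Rightarrow> nat list \<Rightarrow> nat \<Rightarrow> (nat \<Rightarrow> nat) \<Rightarrow> (nat \<Rightarrow> nat) \<Rightarrow> nat" where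
  "aff p s es a l x = a + (\<Sum>i<length es. l i * p ^ (s - es ! i) * x i)"

definition vars :: "nat \<Rightarrow> nat list \<Rightarrow> (nat \<Rightarrow> nat) set" where
  "vars p es = (\<Pi>\<^sub>E i\<in>{..<length es}. {..<p ^ (es ! i)})"

definition pts :: "nat \<Rightarrow> nat \<Rightarrow> nat list \<Rightarrow> ((nat \<Rightarrow> nat) \<times> nat) set" where
  "pts p s es = vars p es \<times> {..<p ^ (s - 1)}"

text \<open>Writing an element of \<open>T\<^sub>i\<close> as \<open>p ^ (s - e) * x\<close> with \<open>e = s - i + 1\<close> and \<open>x < p ^ e\<close>,
  the list \<open>es\<close> records the exponent \<open>e\<close> of each row of the generator matrix but the first;
  the second component of a point selects a column of \<open>Y\<close>.\<close>

definition code :: "nat \<Rightarrow> nat \<Rightarrow> nat list \<Rightarrow> ((nat \<Rightarrow> nat) \<times> nat \<Rightarrow> nat) set" where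
  "code p s es = {\<lambda>(x, j). gray_eval p s (aff p s es a l x) j | a l. True}"

lemma codeI: "(\<lambda>(x, j). gray_eval p s (aff p s es a l x) j) \<in> code p s es"
  by (auto simp: code_def)

lemma codeE:
  assumes "c \<in> code p s es"
  obtains a l where "c = (\<lambda>(x, j). gray_eval p s (aff p s es a l x) j)"
  using assms by (auto simp: code_def)

lemma vars_less: "x \<in> vars p es \<Longrightarrow> i < length es \<Longrightarrow> x i < p ^ (es ! i)"
  by (auto simp: vars_def PiE_iff)

lemma card_pts: "card (pts p s es) = p ^ (sum_list es + (s - 1))"
  by (simp add: pts_def vars_def card_PiE card_cartesian_product power_sum sum_list_sum_nth
      atLeast0LessThan power_add)

section \<open>Gray coordinates and row combinations\<close>

lemma gray_eval_cong:
  assumes "p > 0" "s \<ge> 1" "[u = v] (mod p ^ s)"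
  shows "gray_eval p s u j = gray_eval p s v j"
  using digit_cong[OF assms(1) _ assms(3)] assms(2) by (auto simp: gray_eval_def intro!: sum.cong)

text \<open>A multiple of \<open>p ^ (s - 1)\<close> changes only the top digit, which enters every
  Gray coordinate with coefficient one. This is how elements of order dividing \<open>p\<close>
  become periods.\<close>

lemma gray_eval_add_top:
  assumes "p > 0"
  shows "[gray_eval p s (u + p ^ (s - 1) * c) j = gray_eval p s u j + c] (mod p)"
proof -
  have "gray_eval p s (u + p ^ (s - 1) * c) j
      = digit p (s - 1) (u + p ^ (s - 1) * c) + (\<Sum>k<s - 1. digit p k u * digit p k j)"
    by (simp add: gray_eval_def digit_add_power_lower[OF assms])
  also have "[\<dots> = (digit p (s - 1) u + c) + (\<Sum>k<s - 1. digit p k u * digit p k j)] (mod p)"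
    by (intro cong_add cong_refl digit_add_power_same[OF assms])
  finally show ?thesis by (simp add: gray_eval_def ac_simps)
qed

text \<open>At level \<open>Suc s \<ge> 2\<close> the lowest digit \<open>r\<close> is not the top
  one, so it meets the lowest digit \<open>y\<close> of the column index and contributes
  \<open>r * y\<close>. A row of order \<open>p\<close> with coefficient \<open>r\<close> and
  variable \<open>y\<close> contributes the same at level \<open>s\<close>.\<close>

lemma gray_eval_Suc:
  assumes "p > 0" "s \<ge> 1" "r < p" "y < p"
  shows "gray_eval p (Suc s) (r + p * g) (y + p * j) = gray_eval p s g j + r * y"
proof -
  obtain s0 where s: "s = Suc s0" using assms(2) by (cases s) auto
  show ?thesis using assms
    by (simp add: gray_eval_def s sum.lessThan_Suc_shift digit_Suc digit_0 del: sum.lessThan_Suc)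
qed

lemma aff_Suc:
  assumes "\<forall>e\<in>set es. e \<le> s"
  shows "aff p (Suc s) es (r + p * g) l x = r + p * aff p s es g l x"
proof -
  have "l i * p ^ (Suc s - es ! i) * x i = p * (l i * p ^ (s - es ! i) * x i)" if "i < length es" for i
    using assms that by (simp add: Suc_diff_le)
  then have "(\<Sum>i<length es. l i * p ^ (Suc s - es ! i) * x i) = p * (\<Sum>i<length es. l i * p ^ (s - es ! i) * x i)"
    unfolding sum_distrib_left by (intro sum.cong) (simp_all only: lessThan_iff)
  then show ?thesis by (simp add: aff_def add_mult_distrib2)
qed

lemma aff_append:
  "aff p s (es @ [1]) g l x = aff p s es g l x + p ^ (s - 1) * (l (length es) * x (length es))"
  by (simp add: aff_def nth_append)

lemma aff_cong: "(\<And>i. i < length es \<Longrightarrow> l i = l' i) \<Longrightarrow> (\<And>i. i < length es \<Longrightarrow> x i = x' i) \<Longrightarrow>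
   aff p s es a l x = aff p s es a l' x'"
  by (simp add: aff_def)

text \<open>By \<open>gray_eval_Suc\<close> the lowest digit of the column index acts as an
  additional variable of exponent 1, with the lowest digit of the constant \<open>a\<close> as its
  coefficient; the remaining digits of both pass to level \<open>s\<close>. The bound on
  \<open>es\<close> makes the other rows divisible by \<open>p\<close>, so that none of them reaches
  the lowest digit.\<close>

lemma cequiv_Suc:
  assumes p: "p > 0" and s: "s \<ge> 1" and es: "\<forall>e\<in>set es. e \<le> s"
  shows "cequiv p (pts p (Suc s) es) (code p (Suc s) es) (pts p s (es @ [1])) (code p s (es @ [1]))"
proof (rule cequivI_bij)
  let ?n = "length es"
  let ?\<pi> = "\<lambda>(x, j). (restrict x {..<?n}, x ?n + p * j) :: (nat \<Rightarrow> nat) \<times> nat"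
  have ps: "p ^ s = p * p ^ (s - 1)" using s by (cases s) auto
  show "bij_betw ?\<pi> (pts p s (es @ [1])) (pts p (Suc s) es)"
  proof (rule bij_betw_byWitness[where f' = "\<lambda>(x, j). (x(?n := j mod p), j div p)"])
    show "\<forall>a\<in>pts p s (es @ [1]). (\<lambda>(x, j). (x(?n := j mod p), j div p)) (?\<pi> a) = a"
    proof
      fix a assume a: "a \<in> pts p s (es @ [1])"
      then obtain x j where xj: "a = (x, j)" "(x, j) \<in> pts p s (es @ [1])" by (cases a) auto
      have "x \<in> extensional {..<Suc ?n}" "x ?n < p"
        using xj vars_less[of x p "es @ [1]" ?n] by (auto simp: pts_def vars_def PiE_iff)
      moreover from this(1) have "(restrict x {..<?n})(?n := x ?n) = x"
        by (auto simp: extensional_def fun_eq_iff)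
      ultimately show "(\<lambda>(x, j). (x(?n := j mod p), j div p)) (?\<pi> a) = a" by (simp add: xj(1))
    qed
    have "restrict (x(?n := y)) {..<?n} = x" if "x \<in> extensional {..<?n}" for x :: "nat \<Rightarrow> nat" and y
      using that by (auto simp: extensional_def fun_eq_iff)
    then show "\<forall>a\<in>pts p (Suc s) es. ?\<pi> ((\<lambda>(x, j). (x(?n := j mod p), j div p)) a) = a"
      by (auto simp: pts_def vars_def PiE_iff)
    have "y + p * j < p ^ s" if "y < p" "j < p ^ (s - 1)" for y j
    proof -
      have "y + p * j < p * Suc j" using that by simp
      also have "\<dots> \<le> p * p ^ (s - 1)" using that(2) by (intro mult_le_mono2) simp
      finally show ?thesis by (simp add: ps)
    qed
    moreover have "x i < p ^ (es ! i)" if "x \<in> vars p (es @ [1])" "i < ?n" for x i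
      using vars_less[OF that(1), of i] that(2) by (simp add: nth_append)
    moreover have "x ?n < p" if "x \<in> vars p (es @ [1])" for x
      using vars_less[OF that, of ?n] by simp
    ultimately have "?\<pi> (x, j) \<in> pts p (Suc s) es" if "(x, j) \<in> pts p s (es @ [1])" for x j
      using that unfolding pts_def by (auto simp: vars_def[of p es])
    then show "?\<pi> ` pts p s (es @ [1]) \<subseteq> pts p (Suc s) es" by auto
    have "j div p < p ^ (s - 1)" if "j < p ^ s" for j
      using that by (simp add: ps less_mult_imp_div_less mult.commute)
    then show "(\<lambda>(x, j). (x(?n := j mod p), j div p)) ` pts p (Suc s) es \<subseteq> pts p s (es @ [1])"
      using p by (auto simp: pts_def vars_def PiE_iff nth_append extensional_def less_Suc_eq)
  qed
  have key: "[gray_eval p s (aff p s (es @ [1]) g l x) j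
      = gray_eval p (Suc s) (aff p (Suc s) es (l ?n mod p + p * g) l (restrict x {..<?n})) (x ?n + p * j)] (mod p)"
    if "x ?n < p" for g l x j
  proof -
    have "[gray_eval p s (aff p s (es @ [1]) g l x) j = gray_eval p s (aff p s es g l x) j + l ?n * x ?n] (mod p)"
      unfolding aff_append by (rule gray_eval_add_top[OF p])
    also have "[gray_eval p s (aff p s es g l x) j + l ?n * x ?n
        = gray_eval p s (aff p s es g l x) j + (l ?n mod p) * x ?n] (mod p)"
      by (intro cong_add cong_mult cong_refl) (simp add: cong_def)
    also have "gray_eval p s (aff p s es g l x) j + (l ?n mod p) * x ?n
        = gray_eval p (Suc s) (l ?n mod p + p * aff p s es g l x) (x ?n + p * j)"
      using gray_eval_Suc[OF p s _ that] p by simp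
    also have "l ?n mod p + p * aff p s es g l x
        = aff p (Suc s) es (l ?n mod p + p * g) l (restrict x {..<?n})"
      unfolding aff_Suc[OF es] by (auto intro!: aff_cong)
    finally show ?thesis .
  qed
  have xn: "x ?n < p" if "(x, j) \<in> pts p s (es @ [1])" for x j
    using that vars_less[of x p "es @ [1]" ?n] by (simp add: pts_def)
  show "\<exists>d\<in>code p s (es @ [1]). \<forall>j\<in>pts p s (es @ [1]). [d j = c (?\<pi> j)] (mod p)"
    if c: "c \<in> code p (Suc s) es" for c
  proof -
    obtain a l where cl: "c = (\<lambda>(x, j). gray_eval p (Suc s) (aff p (Suc s) es a l x) j)"
      using c by (rule codeE)
    let ?l = "l(?n := a mod p)"
    have "aff p (Suc s) es a l x = aff p (Suc s) es (?l ?n mod p + p * (a div p)) ?l x" for x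
      by (auto intro!: aff_cong)
    then show ?thesis
      using key[of _ "a div p" ?l] xn
      by (intro bexI[OF _ codeI[of p s "es @ [1]" "a div p" ?l]]) (auto simp: cl)
  qed
  show "\<exists>c\<in>code p (Suc s) es. \<forall>j\<in>pts p s (es @ [1]). [d j = c (?\<pi> j)] (mod p)"
    if d: "d \<in> code p s (es @ [1])" for d
  proof -
    obtain a l where dl: "d = (\<lambda>(x, j). gray_eval p s (aff p s (es @ [1]) a l x) j)"
      using d by (rule codeE)
    show ?thesis
      using key[of _ a l] xn
      by (intro bexI[OF _ codeI[of p "Suc s" es "l ?n mod p + p * a" l]]) (auto simp: dl)
  qed
qed

text \<open>On a fixed residue class each variable is \<open>xb i mod p\<close> plus
  \<open>p\<close> times a new variable whose exponent is one less. The fixed residues only shift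
  the constant term.\<close>

lemma cequiv_fibre:
  assumes p: "p > 0" and s: "s \<ge> 1" and es: "\<forall>e\<in>set es. e \<le> s" and xb: "xb \<in> vars p es"
  shows "cequiv p {(x, j) \<in> pts p s es. \<forall>i<length es. [xb i = x i] (mod p)} (code p s es)
    (pts p s (map (\<lambda>e. e - 1) es)) (code p s (map (\<lambda>e. e - 1) es))"
proof (rule cequivI_bij)
  let ?n = "length es" and ?es = "map (\<lambda>e. e - 1) es"
  let ?\<pi> = "\<lambda>(x, j). (\<lambda>i\<in>{..<?n}. xb i mod p + p * x i, j) :: (nat \<Rightarrow> nat) \<times> nat"
  let ?\<rho> = "\<lambda>(x, j). (\<lambda>i\<in>{..<?n}. x i div p, j) :: (nat \<Rightarrow> nat) \<times> nat"
  let ?F = "{(x, j) \<in> pts p s es. \<forall>i<length es. [xb i = x i] (mod p)}"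
  \<comment> \<open>An exponent 0 forces the value 0, and the truncated \<open>0 - 1 = 0\<close>
    keeps this trivial variable as it is.\<close>
  have z: "xb i = 0" if "i < ?n" "es ! i = 0" for i
    using vars_less[OF xb that(1)] that(2) by simp
  have lt1: "xb i mod p + p * y < p ^ (es ! i)" if "i < ?n" "y < p ^ (es ! i - 1)" for i y
  proof (cases "es ! i")
    case 0
    then show ?thesis using z that by simp
  next
    case (Suc e)
    have "xb i mod p + p * y < p * Suc y" using p by simp
    also have "\<dots> \<le> p * p ^ e" using that(2) Suc by (intro mult_le_mono2) simp
    finally show ?thesis by (simp add: Suc)
  qed
  have lt2: "y div p < p ^ (e - 1)" if "y < p ^ e" for y e
    using that by (cases e) (simp_all add: less_mult_imp_div_less mult.commute)
  show "bij_betw ?\<pi> (pts p s ?es) ?F"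
  proof (rule bij_betw_byWitness[where f' = ?\<rho>])
    show "\<forall>a\<in>pts p s ?es. ?\<rho> (?\<pi> a) = a"
      using p by (auto simp: pts_def vars_def PiE_iff extensional_def fun_eq_iff)
    show "\<forall>a\<in>?F. ?\<pi> (?\<rho> a) = a"
      by (auto simp: pts_def vars_def PiE_iff extensional_def fun_eq_iff cong_def)
    show "?\<pi> ` pts p s ?es \<subseteq> ?F"
      using lt1 by (auto simp: pts_def vars_def PiE_iff cong_def)
    show "?\<rho> ` ?F \<subseteq> pts p s ?es"
      using lt2 by (auto simp: pts_def vars_def PiE_iff split: if_splits)
  qed
  define S where "S l = (\<Sum>i<?n. l i * p ^ (s - es ! i) * (xb i mod p))" for l :: "nat \<Rightarrow> nat"
  have key: "aff p s es a l (\<lambda>i\<in>{..<?n}. xb i mod p + p * x i) = aff p s ?es (a + S l) l x"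
    if x: "x \<in> vars p ?es" for a l x
  proof -
    have "l i * p ^ (s - es ! i) * (xb i mod p + p * x i)
        = l i * p ^ (s - es ! i) * (xb i mod p) + l i * p ^ (s - (es ! i - 1)) * x i" if "i < ?n" for i
    proof (cases "es ! i")
      case 0
      then have "x i = 0" using vars_less[OF x, of i] that by simp
      then show ?thesis by simp
    next
      case (Suc e)
      have "Suc e \<le> s" using es that Suc nth_mem by metis
      then have "s - e = Suc (s - Suc e)" by simp
      then show ?thesis by (simp add: Suc algebra_simps)
    qed
    then show ?thesis by (simp add: aff_def S_def sum.distrib)
  qed
  show "\<exists>d\<in>code p s ?es. \<forall>j\<in>pts p s ?es. [d j = c (?\<pi> j)] (mod p)" if c: "c \<in> code p s es" for c
  proof -
    obtain a l where cl: "c = (\<lambda>(x, j). gray_eval p s (aff p s es a l x) j)"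
      using c by (rule codeE)
    show ?thesis
      by (intro bexI[OF _ codeI[of p s ?es "a + S l" l]]) (auto simp: cl key pts_def)
  qed
  show "\<exists>c\<in>code p s es. \<forall>j\<in>pts p s ?es. [d j = c (?\<pi> j)] (mod p)" if d: "d \<in> code p s ?es" for d
  proof -
    obtain a l where dl: "d = (\<lambda>(x, j). gray_eval p s (aff p s ?es a l x) j)"
      using d by (rule codeE)
    \<comment> \<open>Since \<open>p ^ s - 1\<close> is -1 modulo \<open>p ^ s\<close>, this takes
      the shift \<open>S l\<close> back.\<close>
    let ?a = "a + (p ^ s - 1) * S l"
    have "?a + S l = a + p ^ s * S l"
      using p by (metis One_nat_def Suc_pred add.assoc add.commute mult_Suc zero_less_power)
    then have "aff p s ?es (?a + S l) l x = aff p s ?es a l x + p ^ s * S l" for x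
      by (simp add: aff_def)
    then have "gray_eval p s (aff p s ?es (?a + S l) l x) j = gray_eval p s (aff p s ?es a l x) j" for x j
      by (intro gray_eval_cong[OF p s]) (simp add: cong_def)
    then show ?thesis
      by (intro bexI[OF _ codeI[of p s es ?a l]]) (auto simp: dl key pts_def)
  qed
qed

section \<open>Periods\<close>

text \<open>Column 0 shows the top digit alone, and column \<open>p ^ k\<close> shows the top digit
  plus digit \<open>k\<close>. Adding Gray images therefore means adding without carry in every
  digit.\<close>

lemma gray_eval_period_digits:
  assumes p: "p > 1" and s: "s \<ge> 1"
    and G: "\<And>j. j < p ^ (s - 1) \<Longrightarrow> [gray_eval p s A j = gray_eval p s h j + gray_eval p s f j] (mod p)"
    and k: "k < s"
  shows "digit p k A = (digit p k f + digit p k h) mod p"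
proof -
  have top: "[digit p (s - 1) A = digit p (s - 1) h + digit p (s - 1) f] (mod p)"
    using G[of 0] p by (simp add: gray_eval_def)
  have "[digit p k A = digit p k f + digit p k h] (mod p)"
  proof (cases "k = s - 1")
    case True
    then show ?thesis using top by (simp add: add.commute)
  next
    case False
    then have k': "k < s - 1" using k by simp
    have ev: "gray_eval p s u (p ^ k) = digit p (s - 1) u + digit p k u" for u
      using p k' by (simp add: gray_eval_def digit_power if_distrib[of "(*) _"] cong: if_cong)
    have "[digit p (s - 1) A + digit p k A
        = (digit p (s - 1) h + digit p (s - 1) f) + (digit p k f + digit p k h)] (mod p)"
      using G[of "p ^ k"] p k' by (simp add: ev ac_simps)
    moreover have "[digit p (s - 1) A + digit p k A
        = (digit p (s - 1) h + digit p (s - 1) f) + digit p k A] (mod p)"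
      using top by (simp add: cong_add_rcancel_nat)
    ultimately show ?thesis
      by (meson cong_add_lcancel_nat cong_sym cong_trans)
  qed
  then show ?thesis using digit_less[of p k A] p by (simp add: cong_def)
qed

section \<open>Restriction to coordinate axes and the shape of periods\<close>

lemma aff_line:
  assumes "i < length es"
  shows "aff p s es a l (\<lambda>k\<in>{..<length es}. if k = i then t else 0) = a + (l i * p ^ (s - es ! i)) * t"
proof -
  have "(\<Sum>k<length es. l k * p ^ (s - es ! k) * (\<lambda>k\<in>{..<length es}. if k = i then t else 0) k)
      = (\<Sum>k<length es. if k = i then l i * p ^ (s - es ! i) * t else 0)"
    by (intro sum.cong) auto
  then show ?thesis using assms by (simp add: aff_def)
qed

lemma vars_line:
  assumes "p > 0" "i < length es" "t < p ^ (es ! i)"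
  shows "(\<lambda>k\<in>{..<length es}. if k = i then t else 0) \<in> vars p es"
  using assms by (auto simp: vars_def)

lemma not_dvd_power_decompose:
  fixes \<mu> :: nat
  assumes p: "prime p" and n: "\<not> p ^ n dvd \<mu>"
  obtains m u where "m < n" "\<mu> = p ^ m * u" "\<not> p dvd u"
proof -
  have "\<mu> \<noteq> 0" "\<not> is_unit p" using n p by (auto intro: Nat.gr0I)
  then obtain u where u: "\<mu> = p ^ multiplicity p \<mu> * u" "\<not> p dvd u"
    by (metis multiplicity_decompose' mult.commute)
  moreover have "multiplicity p \<mu> < n"
    using n by (meson leI multiplicity_dvd')
  ultimately show ?thesis using that by blast
qed

lemma cong_affine_surj:
  fixes g u r :: nat
  assumes p: "prime p" and u: "\<not> p dvd u"
  obtains t where "t < p" "[g + u * t = r] (mod p)"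
proof -
  have p0: "p > 0" using p prime_gt_0_nat by blast
  have "coprime u p" using p u prime_imp_coprime coprime_commute by blast
  then obtain w where w: "[u * w = 1] (mod p)" using cong_solve_coprime_nat by auto
  let ?z = "r + (p - 1) * g"
  have "[g + u * ((w * ?z) mod p) = g + u * (w * ?z)] (mod p)"
    by (intro cong_add cong_mult cong_refl) (simp add: cong_def)
  also have "g + u * (w * ?z) = g + (u * w) * ?z" by simp
  also have "[\<dots> = g + 1 * ?z] (mod p)" by (intro cong_add cong_mult cong_refl w)
  also have "g + 1 * ?z = r + p * g" using p0 by (cases p) auto
  also have "[\<dots> = r] (mod p)" by (simp add: cong_def)
  finally show ?thesis using that[of "(w * ?z) mod p"] p0 by simp
qed

text \<open>An entry \<open>s\<close> of \<open>es\<close> is a row of full order besides the row of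
  ones, so the last clause encodes s = 1 or t_1 \<ge> 2.\<close>

definition nondegenerate :: "nat \<Rightarrow> nat list \<Rightarrow> bool" where
  "nondegenerate s es \<longleftrightarrow> s \<ge> 1 \<and> (\<forall>e\<in>set es. e \<le> s) \<and> (s = 1 \<or> s \<in> set es)"

text \<open>The conclusion describes elements of order dividing \<open>p\<close>. Otherwise a
  coordinate axis and a suitable second word produce a carry out of some position \<open>m\<close>
  with \<open>m + 2 \<le> s\<close> at some points of the axis but not at others, against
  \<open>carry_const\<close>.\<close>

lemma period_coefficients:
  assumes p: "prime p" "p \<ge> 3" and nd: "nondegenerate s es"
    and D: "\<And>a' l'. \<exists>A L. \<forall>x\<in>vars p es. \<forall>k<s.
      digit p k (aff p s es A L x) = (digit p k (aff p s es a l x) + digit p k (aff p s es a' l' x)) mod p"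
  shows "p ^ (s - 1) dvd a" and "\<And>i. i < length es \<Longrightarrow> p ^ (s - 1) dvd l i * p ^ (s - es ! i)"
proof -
  have p1: "p > 1" "p > 0" using p(2) by auto
  have es: "\<forall>e\<in>set es. e \<le> s" and s: "s \<ge> 1" using nd by (auto simp: nondegenerate_def)
  have line: "\<exists>\<alpha> \<beta>. \<forall>k<s. \<forall>t<p. digit p k (\<alpha> + \<beta> * t)
      = (digit p k (a + (l i * p ^ (s - es ! i)) * t) + digit p k (a' + (l' i * p ^ (s - es ! i)) * t)) mod p"
    if i: "i < length es" "es ! i \<ge> 1" for i a' l'
  proof -
    obtain A L where AL: "\<forall>x\<in>vars p es. \<forall>k<s.
      digit p k (aff p s es A L x) = (digit p k (aff p s es a l x) + digit p k (aff p s es a' l' x)) mod p"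
      using D[of a' l'] by blast
    have "t < p ^ (es ! i)" if "t < p" for t
      using that i(2) p1(1) using self_le_power[of p "es ! i"] by simp
    then show ?thesis
      using AL vars_line[OF p1(2) i(1)] by (metis (no_types, lifting) aff_line[OF i(1)])
  qed
  show l: "p ^ (s - 1) dvd l i * p ^ (s - es ! i)" if i: "i < length es" for i
  proof (rule ccontr)
    let ?\<mu> = "l i * p ^ (s - es ! i)"
    assume n: "\<not> p ^ (s - 1) dvd ?\<mu>"
    then obtain m u where m: "m < s - 1" and \<mu>: "?\<mu> = p ^ m * u" and u: "\<not> p dvd u"
      by (rule not_dvd_power_decompose[OF p(1)])
    have "es ! i \<ge> 1"
    proof (rule ccontr)
      assume "\<not> es ! i \<ge> 1"
      then have "p ^ (s - 1) dvd ?\<mu>" by (simp add: dvd_mult le_imp_power_dvd)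
      then show False using n by simp
    qed
    \<comment> \<open>The second word is the constant \<open>p ^ m\<close>: a carry out of
      \<open>m\<close> occurs exactly where digit \<open>m\<close> of the first word is
      \<open>p - 1\<close>. As \<open>u\<close> is a unit modulo \<open>p\<close>, this digit takes
      every value on the axis.\<close>
    from line[OF i this, of "p ^ m" "\<lambda>_. 0"] obtain \<alpha> \<beta> where AB: "\<forall>k<s. \<forall>t<p. digit p k (\<alpha> + \<beta> * t)
      = (digit p k (a + ?\<mu> * t) + digit p k (p ^ m + 0 * t)) mod p" by auto
    have carry: "digit p m (a + ?\<mu> * t) + digit p m (p ^ m + 0 * t) < p \<longleftrightarrow>
         digit p m (a + ?\<mu> * t') + digit p m (p ^ m + 0 * t') < p" if "t < p" "t' < p" for t t'
      by (rule carry_const[OF p _ _ that, of m _ _ \<alpha> \<beta>]) (use AB m in auto)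
    have dig: "digit p m (a + ?\<mu> * t) = r" if "[digit p m a + u * t = r] (mod p)" "r < p" for t r
    proof -
      have "[digit p m (a + p ^ m * (u * t)) = digit p m a + u * t] (mod p)"
        by (rule digit_add_power_same[OF p1(2)])
      then have "[digit p m (a + p ^ m * (u * t)) = r] (mod p)" using that(1) cong_trans by blast
      then show ?thesis
        using that(2) digit_less[OF p1(2)] unfolding \<mu> by (simp add: cong_def mult.assoc)
    qed
    obtain t where t: "t < p" "[digit p m a + u * t = 0] (mod p)" by (rule cong_affine_surj[OF p(1) u])
    obtain t' where t': "t' < p" "[digit p m a + u * t' = p - 1] (mod p)" by (rule cong_affine_surj[OF p(1) u])
    have "digit p m (a + ?\<mu> * t) = 0" "digit p m (a + ?\<mu> * t') = p - 1"
      using dig[OF t(2)] dig[OF t'(2)] p1 by auto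
    then show False using carry[OF t(1) t'(1)] p1 by (simp add: digit_power)
  qed
  show "p ^ (s - 1) dvd a"
  proof (rule ccontr)
    assume n: "\<not> p ^ (s - 1) dvd a"
    then obtain m u where m: "m < s - 1" and a: "a = p ^ m * u" and u: "\<not> p dvd u"
      by (rule not_dvd_power_decompose[OF p(1)])
    have "s \<in> set es" using m nd by (auto simp: nondegenerate_def)
    then obtain i where i: "i < length es" "es ! i = s" by (auto simp: in_set_conv_nth)
    obtain q where q: "l i * p ^ (s - es ! i) = p ^ (s - 1) * q" using l[OF i(1)] by blast
    \<comment> \<open>On an axis of full order \<open>p ^ m * t\<close> is available as second word.
      Digit \<open>m\<close> of the first word is constant and nonzero there, so no carry arises at
      \<open>t = 0\<close> and one arises at \<open>t = p - 1\<close>.\<close>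
    from line[OF i(1), of 0 "\<lambda>_. p ^ m"] i(2) s obtain \<alpha> \<beta> where AB: "\<forall>k<s. \<forall>t<p. digit p k (\<alpha> + \<beta> * t)
      = (digit p k (a + (p ^ (s - 1) * q) * t) + digit p k (0 + p ^ m * t)) mod p" unfolding q by auto
    have "digit p m (a + (p ^ (s - 1) * q) * 0) + digit p m (0 + p ^ m * 0) < p \<longleftrightarrow>
         digit p m (a + (p ^ (s - 1) * q) * (p - 1)) + digit p m (0 + p ^ m * (p - 1)) < p"
      by (rule carry_const[OF p, of m _ _ \<alpha> \<beta>]) (use AB m p1 in auto)
    moreover have "digit p m (a + (p ^ (s - 1) * q) * (p - 1)) = digit p m a"
      using digit_add_power_lower[OF p1(2) m, of a "q * (p - 1)"] by (simp add: mult.assoc)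
    moreover have "digit p m (p ^ m * (p - 1)) = p - 1"
      using p1 by (simp add: digit_def)
    moreover have "digit p m a \<noteq> 0"
      using u p1 by (simp add: a digit_def dvd_eq_mod_eq_0)
    ultimately show False using digit_less[OF p1(2), of m a] by simp
  qed
qed

text \<open>A period is congruent to a codeword, being its own sum with the zero word. By
  \<open>period_coefficients\<close> the row combination behind it is divisible by
  \<open>p ^ (s - 1)\<close>, so modulo \<open>p\<close> the period is an affine function of
  \<open>x\<close> that does not depend on \<open>j\<close>.\<close>

lemma period_mod:
  assumes p: "prime p" "p \<ge> 3" and nd: "nondegenerate s es"
    and v: "period p (pts p s es) (code p s es) v"
    and x: "(x, j) \<in> pts p s es" and x': "(x', j') \<in> pts p s es"
    and xx: "\<forall>i<length es. [x i = x' i] (mod p)"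
  shows "[v (x, j) = v (x', j')] (mod p)"
proof -
  have p1: "p > 1" "p > 0" using p(2) by auto
  have s: "s \<ge> 1" using nd by (auto simp: nondegenerate_def)
  have "gray_eval p s (aff p s es 0 (\<lambda>_. 0) x) j = 0" for x j
    by (simp add: aff_def gray_eval_def)
  then obtain a l where v_al: "\<forall>(x, j)\<in>pts p s es. [gray_eval p s (aff p s es a l x) j = v (x, j)] (mod p)"
    using v[unfolded period_def, rule_format, OF codeI[of p s es 0 "\<lambda>_. 0"]]
    by (fastforce elim!: codeE)
  have D: "\<exists>A L. \<forall>x\<in>vars p es. \<forall>k<s.
      digit p k (aff p s es A L x) = (digit p k (aff p s es a l x) + digit p k (aff p s es a' l' x)) mod p"
    for a' l'
  proof -
    obtain d where "d \<in> code p s es" and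
      d: "\<forall>x\<in>pts p s es. [d x = (\<lambda>(x, j). gray_eval p s (aff p s es a' l' x) j) x + v x] (mod p)"
      using v codeI[of p s es a' l'] unfolding period_def by blast
    then obtain A L where AL: "d = (\<lambda>(x, j). gray_eval p s (aff p s es A L x) j)" by (auto elim: codeE)
    have "digit p k (aff p s es A L x) = (digit p k (aff p s es a l x) + digit p k (aff p s es a' l' x)) mod p"
      if x: "x \<in> vars p es" and k: "k < s" for x k
    proof (rule gray_eval_period_digits[OF p1(1) s _ k])
      fix j assume "j < p ^ (s - 1)"
      then have xj: "(x, j) \<in> pts p s es" using x by (simp add: pts_def)
      have "[gray_eval p s (aff p s es A L x) j = gray_eval p s (aff p s es a' l' x) j + v (x, j)] (mod p)"
        using d xj by (auto simp: AL)
      also have "[gray_eval p s (aff p s es a' l' x) j + v (x, j)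
        = gray_eval p s (aff p s es a' l' x) j + gray_eval p s (aff p s es a l x) j] (mod p)"
        using v_al xj by (intro cong_add cong_refl) (auto intro: cong_sym)
      finally show "[gray_eval p s (aff p s es A L x) j
        = gray_eval p s (aff p s es a' l' x) j + gray_eval p s (aff p s es a l x) j] (mod p)" .
    qed
    then show ?thesis by blast
  qed
  obtain a0 where a0: "a = p ^ (s - 1) * a0"
    using period_coefficients(1)[OF p nd D] by blast
  have "\<forall>i<length es. \<exists>b. l i * p ^ (s - es ! i) = p ^ (s - 1) * b"
    using period_coefficients(2)[OF p nd D] by blast
  then obtain b where b: "\<And>i. i < length es \<Longrightarrow> l i * p ^ (s - es ! i) = p ^ (s - 1) * b i" by metis
  define c where "c x = a0 + (\<Sum>i<length es. b i * x i)" for x :: "nat \<Rightarrow> nat"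
  have "aff p s es a l x = 0 + p ^ (s - 1) * c x" for x
    by (simp add: aff_def a0 b c_def add_mult_distrib2 sum_distrib_left mult.assoc)
  then have "[gray_eval p s (aff p s es a l x) j = c x] (mod p)" for x j
    using gray_eval_add_top[OF p1(2), of s 0 "c x" j] by (simp add: gray_eval_def)
  then have vc: "[v (x, j) = c x] (mod p)" if "(x, j) \<in> pts p s es" for x j
    using v_al that by (metis (no_types, lifting) case_prodD cong_sym cong_trans)
  have "[c x = c x'] (mod p)"
    unfolding c_def using xx by (intro cong_add cong_refl cong_sum cong_mult) auto
  then show ?thesis using vc[OF x] vc[OF x'] by (meson cong_sym cong_trans)
qed

text \<open>Adding \<open>p ^ (es ! i - 1)\<close> to the coefficient of row \<open>i\<close> adds
  \<open>p ^ (s - 1) * x i\<close> before the Gray map, hence \<open>x i\<close> after it.\<close>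

lemma coordinate_period:
  assumes p: "p > 0" and e: "1 \<le> es ! i" "es ! i \<le> s" and i: "i < length es"
  shows "period p (pts p s es) (code p s es) (\<lambda>(x, j). x i)"
  unfolding period_def
proof
  fix c assume "c \<in> code p s es"
  then obtain a l where c: "c = (\<lambda>(x, j). gray_eval p s (aff p s es a l x) j)" by (rule codeE)
  let ?l = "l(i := l i + p ^ (es ! i - 1))"
  have pw: "p ^ (es ! i - 1) * p ^ (s - es ! i) = p ^ (s - 1)"
    using e by (simp flip: power_add)
  have "?l k * p ^ (s - es ! k) * x k
      = l k * p ^ (s - es ! k) * x k + (if k = i then p ^ (s - 1) * x i else 0)" for k x
    using pw by (auto simp: algebra_simps)
  then have "aff p s es a ?l x = aff p s es a l x + p ^ (s - 1) * x i" for x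
    using i by (simp only: aff_def sum.distrib) simp
  then show "\<exists>d\<in>code p s es. \<forall>x\<in>pts p s es. [d x = c x + (\<lambda>(x, j). x i) x] (mod p)"
    using gray_eval_add_top[OF p]
    by (intro bexI[OF _ codeI[of p s es a ?l]]) (auto simp: c)
qed

lemma indist_code_iff:
  assumes p: "prime p" "p \<ge> 3" and nd: "nondegenerate s es"
    and x: "(x, j) \<in> pts p s es" and x': "(x', j') \<in> pts p s es"
  shows "indist p (pts p s es) (code p s es) (x, j) (x', j') \<longleftrightarrow> (\<forall>i<length es. [x i = x' i] (mod p))"
proof
  assume ind: "indist p (pts p s es) (code p s es) (x, j) (x', j')"
  show "\<forall>i<length es. [x i = x' i] (mod p)"
  proof (intro allI impI)
    fix i assume i: "i < length es"
    show "[x i = x' i] (mod p)"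
    proof (cases "es ! i = 0")
      case True
      then have "x i = 0" "x' i = 0"
        using vars_less[of _ p es i] x x' i by (auto simp: pts_def)
      then show ?thesis by simp
    next
      case False
      then have "period p (pts p s es) (code p s es) (\<lambda>(x, j). x i)"
        using p(2) i nd by (intro coordinate_period) (auto simp: nondegenerate_def)
      then show ?thesis using ind by (fastforce simp: indist_def)
    qed
  qed
next
  assume "\<forall>i<length es. [x i = x' i] (mod p)"
  then show "indist p (pts p s es) (code p s es) (x, j) (x', j')"
    using period_mod[OF p nd _ x x'] by (simp add: indist_def)
qed

lemma pts_nonempty: "p > 0 \<Longrightarrow> ((\<lambda>i\<in>{..<length es}. 0), 0) \<in> pts p s es"
  by (auto simp: pts_def vars_def)

text \<open>This makes \<open>s = 1\<close> visible to equivalence. For \<open>s \<ge> 2\<close> the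
  index \<open>j\<close> takes at least two values, which no period separates. For
  \<open>s = 1\<close> only \<open>j = 0\<close> occurs, and exponents of at most 1 let the residues
  modulo \<open>p\<close> determine \<open>x\<close>.\<close>

lemma indist_trivial_iff:
  assumes p: "prime p" "p \<ge> 3" and nd: "nondegenerate s es"
  shows "(\<forall>a\<in>pts p s es. \<forall>b\<in>pts p s es. indist p (pts p s es) (code p s es) a b \<longrightarrow> a = b) \<longleftrightarrow> s = 1"
    (is "?T \<longleftrightarrow> _")
proof
  assume T: ?T
  show "s = 1"
  proof (rule ccontr)
    let ?z = "\<lambda>i\<in>{..<length es}. 0 :: nat"
    assume "s \<noteq> 1"
    then have "1 < p ^ (s - 1)"
      using p(2) nd by (intro one_less_power) (auto simp: nondegenerate_def)
    then have z: "(?z, 1) \<in> pts p s es" "(?z, 0) \<in> pts p s es"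
      using p(2) pts_nonempty[of p es s] by (auto simp: pts_def)
    then have "indist p (pts p s es) (code p s es) (?z, 1) (?z, 0)"
      using indist_code_iff[OF p nd z] by simp
    then have "(?z, 1 :: nat) = (?z, 0)" using T z by metis
    then show False by simp
  qed
next
  assume s: "s = 1"
  have "x = x'" if x: "x \<in> vars p es" "x' \<in> vars p es" and xx: "\<forall>i<length es. [x i = x' i] (mod p)" for x x'
  proof (rule PiE_ext)
    show "x \<in> (\<Pi>\<^sub>E i\<in>{..<length es}. {..<p ^ (es ! i)})" "x' \<in> (\<Pi>\<^sub>E i\<in>{..<length es}. {..<p ^ (es ! i)})"
      using x by (auto simp: vars_def)
    fix i assume i: "i \<in> {..<length es}"
    then have "es ! i \<le> 1" using nd s by (auto simp: nondegenerate_def)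
    then have "p ^ (es ! i) \<le> p" using p(2) by (cases "es ! i") auto
    then have "x i < p" "x' i < p" using vars_less[OF x(1), of i] vars_less[OF x(2), of i] i by auto
    then show "x i = x' i" using xx i cong_less_modulus_unique_nat by blast
  qed
  then show ?T
    using indist_code_iff[OF p nd] s by (auto simp: pts_def)
qed

section \<open>Classification\<close>

lemma count_list_map_pred: "j \<ge> 1 \<Longrightarrow> count_list (map (\<lambda>e. e - 1) es) j = count_list es (j + 1)"
  for es :: "nat list"
  by (induction es) auto

lemma sum_list_count_1: "sum_list es = count_list es 1 + sum_list (filter (\<lambda>e. e \<ge> 2) es)" for es :: "nat list"
  by (induction es) auto

text \<open>Passing to a class of coordinates turns exponent 1 into 0 and so forgets how often it
  occurs; the length of the code, through the sum, brings that number back.\<close>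

lemma count_list_1_eq:
  fixes es es' :: "nat list"
  assumes "\<And>j. j \<ge> 2 \<Longrightarrow> count_list es j = count_list es' j" "sum_list es = sum_list es'"
  shows "count_list es 1 = count_list es' 1"
proof -
  have "mset (filter (\<lambda>e. e \<ge> 2) es) = mset (filter (\<lambda>e. e \<ge> 2) es')"
    using assms(1) by (auto intro!: multiset_eqI simp: count_mset)
  then have "sum_list (filter (\<lambda>e. e \<ge> 2) es) = sum_list (filter (\<lambda>e. e \<ge> 2) es')"
    by (metis sum_mset_sum_list)
  then show ?thesis using sum_list_count_1[of es] sum_list_count_1[of es'] assms(2) by simp
qed

text \<open>Once all exponents have dropped to at most \<open>s - 1\<close>, only the row of ones
  has full order, and \<open>cequiv_Suc\<close> lowers the level. An entry \<open>s\<close> becomes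
  \<open>s - 1\<close>, so nondegeneracy survives at the new level.\<close>

lemma cequiv_indist_fibre:
  assumes p: "prime p" "p \<ge> 3" and nd: "nondegenerate s es" and s: "s \<ge> 2" and b: "b \<in> pts p s es"
  shows "cequiv p {y \<in> pts p s es. indist p (pts p s es) (code p s es) b y} (code p s es)
    (pts p (s - 1) (map (\<lambda>e. e - 1) es @ [1])) (code p (s - 1) (map (\<lambda>e. e - 1) es @ [1]))"
proof -
  have p0: "p > 0" using p(2) by simp
  have es: "\<forall>e\<in>set es. e \<le> s" using nd by (simp add: nondegenerate_def)
  obtain xb jb where b': "b = (xb, jb)" "xb \<in> vars p es" using b by (auto simp: pts_def)
  have F: "{y \<in> pts p s es. indist p (pts p s es) (code p s es) b y}
      = {(x, j) \<in> pts p s es. \<forall>i<length es. [xb i = x i] (mod p)}"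
    using indist_code_iff[OF p nd b[unfolded b'(1)]] by (auto simp: b'(1))
  have "cequiv p {y \<in> pts p s es. indist p (pts p s es) (code p s es) b y} (code p s es)
      (pts p (Suc (s - 1)) (map (\<lambda>e. e - 1) es)) (code p (Suc (s - 1)) (map (\<lambda>e. e - 1) es))"
    unfolding F using cequiv_fibre[OF p0 _ es b'(2)] s by simp
  moreover have "cequiv p (pts p (Suc (s - 1)) (map (\<lambda>e. e - 1) es)) (code p (Suc (s - 1)) (map (\<lambda>e. e - 1) es))
      (pts p (s - 1) (map (\<lambda>e. e - 1) es @ [1])) (code p (s - 1) (map (\<lambda>e. e - 1) es @ [1]))"
    by (rule cequiv_Suc[OF p0]) (use s es in auto)
  ultimately show ?thesis by (rule cequiv_trans)
qed

text \<open>Exponents 0 are left out of the comparison because their variables take only the value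
  0. Both levels descend together, since \<open>indist_trivial_iff\<close> shows that they reach 1
  at the same time.\<close>

theorem cequiv_code_imp_eq:
  assumes p: "prime p" "p \<ge> 3"
    and "nondegenerate s es" "nondegenerate s' es'"
    and "cequiv p (pts p s es) (code p s es) (pts p s' es') (code p s' es')"
  shows "s = s' \<and> (\<forall>j\<ge>1. count_list es j = count_list es' j)"
  using assms(3-)
proof (induction s arbitrary: es s' es' rule: less_induct)
  case (less s)
  let ?X = "pts p s es" and ?C = "code p s es" and ?Y = "pts p s' es'" and ?D = "code p s' es'"
  note nd = less.prems(1) and nd' = less.prems(2)
  have p0: "p > 0" "p > 1" using p(2) by auto
  have s: "s \<ge> 1" "s' \<ge> 1" using nd nd' by (auto simp: nondegenerate_def)
  obtain \<pi> \<alpha> where e: "cequiv_via p \<pi> \<alpha> ?X ?C ?Y ?D" using less.prems(3) by (auto simp: cequiv_def)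
  have bij: "bij_betw \<pi> ?Y ?X" using e by (simp add: cequiv_via_def)
  \<comment> \<open>Equivalent codes have the same length; once the levels agree, this fixes the
    total of the exponents.\<close>
  have "p ^ (sum_list es' + (s' - 1)) = p ^ (sum_list es + (s - 1))"
    using bij_betw_same_card[OF bij] by (simp add: card_pts)
  then have sum: "sum_list es + (s - 1) = sum_list es' + (s' - 1)"
    using p0(2) by (simp add: power_inject_exp)
  have "(\<forall>a\<in>?X. \<forall>b\<in>?X. indist p ?X ?C a b \<longrightarrow> a = b) \<longleftrightarrow> (\<forall>a\<in>?Y. \<forall>b\<in>?Y. indist p ?Y ?D a b \<longrightarrow> a = b)"
  proof -
    have X: "?X = \<pi> ` ?Y" and inj: "inj_on \<pi> ?Y" using bij by (auto simp: bij_betw_def)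
    define R where "R = indist p ?X ?C"
    have "(\<forall>a\<in>?X. \<forall>b\<in>?X. R a b \<longrightarrow> a = b) \<longleftrightarrow> (\<forall>a\<in>?Y. \<forall>b\<in>?Y. R (\<pi> a) (\<pi> b) \<longrightarrow> \<pi> a = \<pi> b)"
      unfolding X by blast
    then have "(\<forall>a\<in>?X. \<forall>b\<in>?X. indist p ?X ?C a b \<longrightarrow> a = b)
        \<longleftrightarrow> (\<forall>a\<in>?Y. \<forall>b\<in>?Y. indist p ?X ?C (\<pi> a) (\<pi> b) \<longrightarrow> \<pi> a = \<pi> b)"
      unfolding R_def .
    also have "\<dots> \<longleftrightarrow> (\<forall>a\<in>?Y. \<forall>b\<in>?Y. indist p ?Y ?D a b \<longrightarrow> a = b)"
      using cequiv_via_indist[OF p0(1) e] inj by (metis inj_onD)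
    finally show ?thesis .
  qed
  then have s1: "s = 1 \<longleftrightarrow> s' = 1"
    unfolding indist_trivial_iff[OF p nd] indist_trivial_iff[OF p nd'] .
  have main: "s = s' \<and> (\<forall>j\<ge>2. count_list es j = count_list es' j)"
  proof (cases "s = 1")
    case True
    then have "s' = 1" using s1 by simp
    have "count_list es j = 0" "count_list es' j = 0" if "j \<ge> 2" for j
      using that nd nd' True \<open>s' = 1\<close> by (auto simp: nondegenerate_def count_list_0_iff)
    then show ?thesis using True \<open>s' = 1\<close> by simp
  next
    case False
    then have s2: "s \<ge> 2" "s' \<ge> 2" using s s1 by auto
    let ?es = "map (\<lambda>e. e - 1) es @ [1]" and ?es' = "map (\<lambda>e. e - 1) es' @ [1]"
    \<comment> \<open>Any point will do: every class yields the same smaller type.\<close>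
    obtain b where b: "b \<in> ?Y" using pts_nonempty[OF p0(1)] by blast
    then have pb: "\<pi> b \<in> ?X" using bij by (auto simp: bij_betw_def)
    have "cequiv p (pts p (s - 1) ?es) (code p (s - 1) ?es) (pts p (s' - 1) ?es') (code p (s' - 1) ?es')"
      using cequiv_trans[OF cequiv_sym[OF p0(1) cequiv_indist_fibre[OF p nd s2(1) pb]]
        cequiv_trans[OF cequiv_via_fibre[OF p0(1) e b] cequiv_indist_fibre[OF p nd' s2(2) b]]] .
    moreover have "nondegenerate (s - 1) ?es" "nondegenerate (s' - 1) ?es'"
      using nd nd' s2 by (auto simp: nondegenerate_def)
    ultimately have IH: "s - 1 = s' - 1 \<and> (\<forall>j\<ge>1. count_list ?es j = count_list ?es' j)"
      using less.IH[of "s - 1" ?es "s' - 1" ?es'] s2 by simp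
    have "count_list es j = count_list es' j" if "j \<ge> 2" for j
    proof -
      have "count_list ?es (j - 1) = count_list ?es' (j - 1)" using IH that by simp
      then show ?thesis using that count_list_map_pred[of "j - 1"] by simp
    qed
    then show ?thesis using IH s2 by auto
  qed
  moreover have "count_list es 1 = count_list es' 1"
    by (rule count_list_1_eq) (use main sum in auto)
  ultimately show ?case
    by (metis One_nat_def Suc_1 Suc_leI le_neq_implies_less)
qed

section \<open>The list codes\<close>

text \<open>Index \<open>i\<close> counts from 0, so \<open>ts ! i\<close> belongs to T_(i+1) and to
  exponent \<open>length ts - i\<close>. At \<open>i = 0\<close> the row of ones is left
  out.\<close>

definition exps :: "nat list \<Rightarrow> nat list" where
  "exps ts = replicate (ts ! 0 - 1) (length ts)
     @ concat (map (\<lambda>i. replicate (ts ! i) (length ts - i)) [1..<length ts])"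

lemma exps_le: "e \<in> set (exps ts) \<Longrightarrow> e \<le> length ts"
  by (auto simp: exps_def)

lemma factors_exps:
  assumes "length ts = s" "s \<ge> 1"
  shows "factors p ts = [1] # map (\<lambda>e. map (\<lambda>j. j * p ^ (s - e)) [0..<p ^ e]) (exps ts)"
proof -
  have "[2..<s + 1] = map Suc [1..<s]" by (simp add: map_Suc_upt numeral_2_eq_2)
  moreover have "Tset p s (Suc i) = map (\<lambda>j. j * p ^ (s - (s - i))) [0..<p ^ (s - i)]" if "i < s" for i
    using that by (simp add: Tset_def Suc_diff_Suc)
  ultimately show ?thesis
    using assms by (cases s) (auto simp: factors_def exps_def Let_def map_concat comp_def Tset_def
      intro!: arg_cong[where f = concat])
qed

lemma in_set_listprod: "z \<in> set (listprod Ss) \<longleftrightarrow> list_all2 (\<lambda>a S. a \<in> set S) z Ss"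
proof (induction Ss arbitrary: z)
  case (Cons S Ss)
  then show ?case by (cases z) auto
qed simp

lemma distinct_listprod: "(\<And>S. S \<in> set Ss \<Longrightarrow> distinct S) \<Longrightarrow> distinct (listprod Ss)"
proof (induction Ss)
  case (Cons S Ss)
  have L: "distinct (listprod Ss)" and S: "distinct S" using Cons by auto
  have "distinct (concat (map (\<lambda>x. map ((#) x) L) S))" if "distinct L" "distinct S" for L :: "nat list list" and S
    using that(2)
  proof (induction S)
    case (Cons x S)
    then show ?case using that(1) by (auto simp: distinct_map)
  qed simp
  then show ?case using L S by simp
qed simp

lemma set_colsA:
  assumes "length ts = s" "s \<ge> 1" "exps ts = es"
  shows "set (colsA p ts) = (\<lambda>x. 1 # map (\<lambda>i. x i * p ^ (s - es ! i)) [0..<length es]) ` vars p es"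
    (is "_ = ?f ` _")
proof -
  have "z \<in> set (colsA p ts) \<longleftrightarrow> (\<exists>x\<in>vars p es. z = ?f x)" for z
  proof
    assume "z \<in> set (colsA p ts)"
    then obtain y where z: "z = 1 # y"
      and y: "list_all2 (\<lambda>a e. a \<in> (\<lambda>j. j * p ^ (s - e)) ` {0..<p ^ e}) y es"
      by (auto simp: colsA_def factors_exps[OF assms(1,2)] assms(3) in_set_listprod list_all2_Cons2
          list_all2_map2)
    have "\<forall>i<length es. \<exists>j. j < p ^ (es ! i) \<and> y ! i = j * p ^ (s - es ! i)"
      using y by (fastforce simp: list_all2_conv_all_nth)
    then obtain x where x: "\<And>i. i < length es \<Longrightarrow> x i < p ^ (es ! i) \<and> y ! i = x i * p ^ (s - es ! i)"
      by metis
    have "length y = length es" using y by (rule list_all2_lengthD)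
    then have "z = ?f (restrict x {..<length es})"
      using x by (auto simp: z intro!: nth_equalityI)
    moreover have "restrict x {..<length es} \<in> vars p es" using x by (auto simp: vars_def)
    ultimately show "\<exists>x\<in>vars p es. z = ?f x" by blast
  next
    assume "\<exists>x\<in>vars p es. z = ?f x"
    then obtain x where x: "x \<in> vars p es" "z = ?f x" by blast
    have "x i * p ^ (s - es ! i) \<in> (\<lambda>j. j * p ^ (s - es ! i)) ` {0..<p ^ (es ! i)}" if "i < length es" for i
      using vars_less[OF x(1) that] by auto
    then show "z \<in> set (colsA p ts)"
      by (simp add: x(2) colsA_def factors_exps[OF assms(1,2)] assms(3) in_set_listprod
          list_all2_map1 list_all2_map2 del: listprod.simps) (simp add: list_all2_conv_all_nth)
  qed
  then show ?thesis by blast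
qed

lemma distinct_colsA:
  assumes "p > 0" "length ts \<ge> 1"
  shows "distinct (colsA p ts)"
  unfolding colsA_def
  by (rule distinct_listprod) (use assms in \<open>auto simp: factors_exps[OF refl assms(2)] distinct_map inj_on_def\<close>)

section \<open>Positions in concatenated words\<close>

lemma bij_div_mod:
  fixes q :: nat
  assumes "q > 0"
  shows "bij_betw (\<lambda>n. (n div q, n mod q)) {..<L * q} ({..<L} \<times> {..<q})"
proof (rule bij_betw_byWitness[where f' = "\<lambda>(m, j). m * q + j"])
  have "m * q + j < L * q" if "m < L" "j < q" for m j
  proof -
    have "m * q + j < Suc m * q" using that(2) by simp
    also have "\<dots> \<le> L * q" using that(1) by (intro mult_le_mono1) simp
    finally show ?thesis .
  qed
  then show "(\<lambda>(m, j). m * q + j) ` ({..<L} \<times> {..<q}) \<subseteq> {..<L * q}" by auto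
qed (use assms in \<open>auto simp: less_mult_imp_div_less\<close>)

lemma concat_nth_uniform:
  assumes "\<And>x. x \<in> set xs \<Longrightarrow> length (f x) = q" "n < length xs * q"
  shows "concat (map f xs) ! n = f (xs ! (n div q)) ! (n mod q)"
  using assms
proof (induction xs arbitrary: n)
  case (Cons x xs)
  have q: "q > 0" using Cons.prems(2) by (cases q) auto
  show ?case
  proof (cases "n < q")
    case True
    then show ?thesis using Cons.prems(1) by (simp add: nth_append)
  next
    case False
    then have "n div q = Suc ((n - q) div q)" "n mod q = (n - q) mod q"
      using q by (simp_all add: le_div_geq le_mod_geq)
    then show ?thesis using False Cons.IH[of "n - q"] Cons.prems by (simp add: nth_append)
  qed
qed simp

definition codeword :: "nat \<Rightarrow> nat list \<Rightarrow> (nat \<Rightarrow> nat) \<Rightarrow> nat list" where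
  "codeword p ts lam = Gray p (length ts)
     (map (\<lambda>z. (\<Sum>i<length z. lam i * z ! i) mod p ^ length ts) (colsA p ts))"

lemma GH_codewords: "GH p ts = range (codeword p ts)"
  by (auto simp: GH_def calH_def codeword_def)

lemma length_gray: "length (gray p s u) = p ^ (s - 1)"
  by (simp add: gray_def)

lemma gray_nth: "j < p ^ (s - 1) \<Longrightarrow> gray p s u ! j = gray_eval p s u j mod p"
  by (simp add: gray_def gray_eval_def)

lemma length_codeword: "length (codeword p ts lam) = length (colsA p ts) * p ^ (length ts - 1)"
  by (simp add: codeword_def Gray_def length_concat comp_def length_gray sum_list_triv)

lemma codeword_nth:
  assumes p: "p > 0" and s: "length ts \<ge> 1"
    and n: "n < length (colsA p ts) * p ^ (length ts - 1)"
    and z: "colsA p ts ! (n div p ^ (length ts - 1))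
      = 1 # map (\<lambda>i. x i * p ^ (length ts - exps ts ! i)) [0..<length (exps ts)]"
  shows "codeword p ts lam ! n =
    gray_eval p (length ts) (aff p (length ts) (exps ts) (lam 0) (\<lambda>i. lam (Suc i)) x)
      (n mod p ^ (length ts - 1)) mod p"
proof -
  let ?q = "p ^ (length ts - 1)" and ?z = "colsA p ts ! (n div p ^ (length ts - 1))"
  have m: "n div ?q < length (colsA p ts)" using n by (simp add: less_mult_imp_div_less)
  have "codeword p ts lam ! n
      = gray p (length ts) ((\<Sum>i<length ?z. lam i * ?z ! i) mod p ^ length ts) ! (n mod ?q)"
    unfolding codeword_def Gray_def using n m by (subst concat_nth_uniform[where q = ?q]) (auto simp: length_gray)
  also have "\<dots> = gray_eval p (length ts) ((\<Sum>i<length ?z. lam i * ?z ! i) mod p ^ length ts) (n mod ?q) mod p"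
    using p by (intro gray_nth) simp
  also have "gray_eval p (length ts) ((\<Sum>i<length ?z. lam i * ?z ! i) mod p ^ length ts) (n mod ?q)
      = gray_eval p (length ts) (\<Sum>i<length ?z. lam i * ?z ! i) (n mod ?q)"
    by (rule gray_eval_cong[OF p s]) (simp add: cong_def)
  also have "(\<Sum>i<length ?z. lam i * ?z ! i) = aff p (length ts) (exps ts) (lam 0) (\<lambda>i. lam (Suc i)) x"
    unfolding z by (simp add: aff_def sum.lessThan_Suc_shift ac_simps del: sum.lessThan_Suc)
  finally show ?thesis .
qed

lemma bij_colsA_vars:
  assumes p: "p > 0" and s: "length ts = s" "s \<ge> 1" and es: "exps ts = es"
  defines "dec \<equiv> \<lambda>z. \<lambda>i\<in>{..<length es}. z ! Suc i div p ^ (s - es ! i)"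
  shows "bij_betw dec (set (colsA p ts)) (vars p es)"
    and "z \<in> set (colsA p ts) \<Longrightarrow> z = 1 # map (\<lambda>i. dec z i * p ^ (s - es ! i)) [0..<length es]"
proof -
  let ?f = "\<lambda>x. 1 # map (\<lambda>i. x i * p ^ (s - es ! i)) [0..<length es]"
  have df: "dec (?f x) = x" if "x \<in> vars p es" for x
  proof
    fix i
    show "dec (?f x) i = x i"
      using that p by (cases "i < length es") (auto simp: dec_def vars_def PiE_iff extensional_def)
  qed
  have cols: "set (colsA p ts) = ?f ` vars p es" by (rule set_colsA[OF s es])
  show "bij_betw dec (set (colsA p ts)) (vars p es)"
    by (rule bij_betw_byWitness[where f' = ?f]) (use df cols in auto)
  assume "z \<in> set (colsA p ts)"
  then obtain x where x: "x \<in> vars p es" "z = ?f x" unfolding cols by blast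
  have "dec z = x" unfolding x(2) by (rule df[OF x(1)])
  then show "z = ?f (dec z)" using x(2) by simp
qed

lemma length_colsA:
  assumes p: "p > 0" and s: "length ts \<ge> 1"
  shows "length (colsA p ts) = p ^ sum_list (exps ts)"
proof -
  have "length (colsA p ts) = card (set (colsA p ts))" using distinct_card[OF distinct_colsA[OF p s]] by simp
  also have "\<dots> = card (vars p (exps ts))" by (rule bij_betw_same_card[OF bij_colsA_vars(1)[OF p refl s refl]])
  also have "\<dots> = p ^ sum_list (exps ts)"
    using card_pts[of p 1 "exps ts"] by (simp add: pts_def card_cartesian_product)
  finally show ?thesis .
qed

lemma sum_list_concat_nat: "sum_list (concat xss) = sum_list (map sum_list xss)" for xss :: "nat list list"
  by (induction xss) auto

text \<open>The row of ones adds \<open>length ts \<ge> 1\<close> to the sum, so the subtraction in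
  \<open>tval\<close> does not truncate. It leaves \<open>length ts - 1\<close>, the exponent of the
  number of Gray coordinates per entry.\<close>

lemma tval_exps:
  assumes "admissible ts"
  shows "(\<Sum>i<length ts. (length ts - i) * ts ! i) = Suc (sum_list (exps ts) + (length ts - 1))"
    and "tval ts = sum_list (exps ts) + (length ts - 1)"
proof -
  obtain s where s: "length ts = Suc s" using assms by (cases "length ts") (auto simp: admissible_def)
  obtain k where k: "ts ! 0 = Suc k" using assms by (cases "ts ! 0") (auto simp: admissible_def)
  have "sum_list (concat (map (\<lambda>i. replicate (ts ! i) (Suc s - i)) [1..<Suc s]))
      = (\<Sum>i\<in>{1..<Suc s}. (Suc s - i) * ts ! i)"
    by (simp add: sum_list_concat_nat comp_def sum_list_replicate mult.commute
        interv_sum_list_conv_sum_set_nat del: upt_Suc)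
  also have "\<dots> = (\<Sum>i<s. (s - i) * ts ! Suc i)"
    unfolding One_nat_def sum.shift_bounds_Suc_ivl by (simp add: atLeast0LessThan)
  finally show *: "(\<Sum>i<length ts. (length ts - i) * ts ! i) = Suc (sum_list (exps ts) + (length ts - 1))"
    by (simp add: exps_def s k sum_list_replicate sum.lessThan_Suc_shift
        del: sum.lessThan_Suc upt_Suc)
  show "tval ts = sum_list (exps ts) + (length ts - 1)"
    unfolding tval_def * by simp
qed

lemma length_codeword_tval: "p > 0 \<Longrightarrow> admissible ts \<Longrightarrow> length (codeword p ts lam) = p ^ tval ts"
  by (simp add: length_codeword length_colsA tval_exps(2) admissible_def flip: power_add)

text \<open>With q = \<open>p ^ (length ts - 1)\<close>, position \<open>n\<close> lies in the block
  of column \<open>n div q\<close> and is Gray coordinate \<open>n mod q\<close> there. Dividing the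
  entries of that column by their powers of \<open>p\<close> gives the point
  \<open>x\<close>.\<close>

lemma cequiv_GH:
  assumes p: "p > 0" and ad: "admissible ts"
  shows "cequiv p (pts p (length ts) (exps ts)) (code p (length ts) (exps ts)) {..<p ^ tval ts} (nth ` GH p ts)"
proof (rule cequivI_bij)
  let ?s = "length ts" and ?es = "exps ts" and ?cols = "colsA p ts"
  let ?q = "p ^ (?s - 1)"
  define dec where "dec z = (\<lambda>i\<in>{..<length ?es}. z ! Suc i div p ^ (?s - ?es ! i))" for z
  let ?\<pi> = "\<lambda>n. (dec (?cols ! (n div ?q)), n mod ?q)"
  have s: "?s \<ge> 1" using ad by (simp add: admissible_def)
  have N: "p ^ tval ts = length ?cols * ?q"
    by (simp add: length_colsA[OF p s] tval_exps(2)[OF ad] power_add)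
  have b1: "bij_betw (\<lambda>n. (n div ?q, n mod ?q)) {..<length ?cols * ?q} ({..<length ?cols} \<times> {..<?q})"
    using p by (intro bij_div_mod) simp
  have "bij_betw (dec \<circ> (!) ?cols) {..<length ?cols} (vars p ?es)"
    by (rule bij_betw_trans[OF bij_betw_nth[OF distinct_colsA[OF p s] refl refl]])
      (unfold dec_def[abs_def], rule bij_colsA_vars(1)[OF p refl s refl])
  from bij_betw_map_prod[OF this bij_betw_id]
  have b2: "bij_betw (map_prod (dec \<circ> (!) ?cols) id) ({..<length ?cols} \<times> {..<?q}) (vars p ?es \<times> {..<?q})" .
  show "bij_betw ?\<pi> {..<p ^ tval ts} (pts p ?s ?es)"
    using bij_betw_trans[OF b1 b2] unfolding N pts_def by (simp add: comp_def)
  have word: "[codeword p ts lam ! n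
      = (\<lambda>(x, j). gray_eval p ?s (aff p ?s ?es (lam 0) (\<lambda>i. lam (Suc i)) x) j) (?\<pi> n)] (mod p)"
    if n: "n < p ^ tval ts" for lam n
  proof -
    have "n div ?q < length ?cols" using n unfolding N by (simp add: less_mult_imp_div_less)
    then have "?cols ! (n div ?q) \<in> set ?cols" by simp
    note z = bij_colsA_vars(2)[OF p refl s refl this, folded dec_def]
    show ?thesis
      unfolding codeword_nth[OF p s n[unfolded N] z] by (simp add: cong_def)
  qed
  show "\<exists>d\<in>(!) ` GH p ts. \<forall>j\<in>{..<p ^ tval ts}. [d j = c (?\<pi> j)] (mod p)" if c: "c \<in> code p ?s ?es" for c
  proof -
    obtain a l where "c = (\<lambda>(x, j). gray_eval p ?s (aff p ?s ?es a l x) j)" using c by (rule codeE)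
    \<comment> \<open>Row 0 is the row of ones, so \<open>case_nat\<close> puts \<open>a\<close> in
      front of the coefficients \<open>l\<close>.\<close>
    then have "\<forall>j\<in>{..<p ^ tval ts}. [codeword p ts (case_nat a l) ! j = c (?\<pi> j)] (mod p)"
      using word[of _ "case_nat a l"] by simp
    then show ?thesis by (auto simp: GH_codewords)
  qed
  show "\<exists>c\<in>code p ?s ?es. \<forall>j\<in>{..<p ^ tval ts}. [d j = c (?\<pi> j)] (mod p)" if d: "d \<in> (!) ` GH p ts" for d
  proof -
    obtain lam where "d = (!) (codeword p ts lam)" using d by (auto simp: GH_codewords)
    then show ?thesis using word[of _ lam] by (intro bexI[OF _ codeI]) auto
  qed
qed

lemma GH_words:
  assumes p: "p > 0" and ad: "admissible ts" and c: "c \<in> GH p ts"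
  shows "length c = p ^ tval ts" "set c \<subseteq> {..<p}"
proof -
  obtain lam where lam: "c = codeword p ts lam" using c by (auto simp: GH_codewords)
  show "length c = p ^ tval ts" by (simp add: lam length_codeword_tval[OF p ad])
  show "set c \<subseteq> {..<p}"
    using p by (auto simp: lam codeword_def Gray_def gray_def)
qed

text \<open>Words of length \<open>N\<close> with entries below \<open>p\<close> are determined by
  their residues, so the congruences of \<open>cequiv\<close> turn into equations of lists.\<close>

lemma code_equiv_iff_cequiv:
  assumes p: "p > 0"
    and C1: "\<And>c. c \<in> C1 \<Longrightarrow> length c = N \<and> set c \<subseteq> {..<p}"
    and C2: "\<And>c. c \<in> C2 \<Longrightarrow> length c = N \<and> set c \<subseteq> {..<p}"
  shows "code_equiv p N C1 C2 \<longleftrightarrow> cequiv p {..<N} (nth ` C1) {..<N} (nth ` C2)"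
proof
  assume "code_equiv p N C1 C2"
  then obtain a \<pi> where \<pi>: "\<pi> permutes {..<N}"
    and C: "C2 = (\<lambda>c. map (\<lambda>j. (a ! j + c ! \<pi> j) mod p) [0..<N]) ` C1"
    by (auto simp: code_equiv_def)
  have "cequiv_via p \<pi> (nth a) {..<N} (nth ` C1) {..<N} (nth ` C2)"
    using permutes_imp_bij[OF \<pi>] by (auto simp: cequiv_via_def C cong_def)
  then show "cequiv p {..<N} (nth ` C1) {..<N} (nth ` C2)" by (auto simp: cequiv_def)
next
  assume "cequiv p {..<N} (nth ` C1) {..<N} (nth ` C2)"
  then obtain \<pi> a where e: "cequiv_via p \<pi> a {..<N} (nth ` C1) {..<N} (nth ` C2)"
    by (auto simp: cequiv_def)
  have b: "bij_betw \<pi> {..<N} {..<N}" using e by (simp add: cequiv_via_def)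
  \<comment> \<open>\<open>permutes\<close> demands the identity outside \<open>{..<N}\<close>, and
    the translation in \<open>code_equiv\<close> must have entries below \<open>p\<close>.\<close>
  define \<rho> where "\<rho> j = (if j < N then \<pi> j else j)" for j
  define a' where "a' = map (\<lambda>j. a j mod p) [0..<N]"
  have "bij_betw \<rho> {..<N} {..<N}" using b by (subst bij_betw_cong[of _ _ \<pi>]) (auto simp: \<rho>_def)
  then have \<rho>: "\<rho> permutes {..<N}" by (rule bij_imp_permutes) (auto simp: \<rho>_def)
  have *: "d = map (\<lambda>j. (a' ! j + c ! \<rho> j) mod p) [0..<N]"
    if d: "d \<in> C2" and dc: "\<forall>j\<in>{..<N}. [d ! j = a j + c ! \<pi> j] (mod p)" for c d
  proof (rule nth_equalityI)
    show "length d = length (map (\<lambda>j. (a' ! j + c ! \<rho> j) mod p) [0..<N])" using C2[OF d] by simp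
    fix j assume "j < length d"
    then have j: "j < N" "d ! j < p" using C2[OF d] nth_mem by auto
    then have "d ! j = (a j + c ! \<pi> j) mod p" using dc[unfolded cong_def, rule_format, of j] by simp
    then show "d ! j = map (\<lambda>j. (a' ! j + c ! \<rho> j) mod p) [0..<N] ! j"
      using j(1) by (simp add: a'_def \<rho>_def mod_simps)
  qed
  have "C2 = (\<lambda>c. map (\<lambda>j. (a' ! j + c ! \<rho> j) mod p) [0..<N]) ` C1"
  proof (intro subset_antisym subsetI)
    fix d assume "d \<in> C2"
    moreover from this obtain c where "c \<in> C1" "\<forall>j\<in>{..<N}. [d ! j = a j + c ! \<pi> j] (mod p)"
      using e by (auto simp: cequiv_via_def)
    ultimately show "d \<in> (\<lambda>c. map (\<lambda>j. (a' ! j + c ! \<rho> j) mod p) [0..<N]) ` C1" using * by blast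
  next
    fix d assume "d \<in> (\<lambda>c. map (\<lambda>j. (a' ! j + c ! \<rho> j) mod p) [0..<N]) ` C1"
    then obtain c where c: "c \<in> C1" "d = map (\<lambda>j. (a' ! j + c ! \<rho> j) mod p) [0..<N]" by blast
    obtain d' where "d' \<in> C2" "\<forall>j\<in>{..<N}. [d' ! j = a j + c ! \<pi> j] (mod p)"
      using e c(1) by (auto simp: cequiv_via_def)
    then show "d \<in> C2" using *[of d' c] c(2) by simp
  qed
  moreover have "length a' = N" "set a' \<subseteq> {..<p}" using p by (auto simp: a'_def)
  ultimately show "code_equiv p N C1 C2" unfolding code_equiv_def using \<rho> by blast
qed

section \<open>Equivalence of types\<close>

definition exps_equiv :: "nat \<Rightarrow> nat list \<Rightarrow> nat list \<Rightarrow> bool" where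
  "exps_equiv p ts ts' \<longleftrightarrow> cequiv p (pts p (length ts) (exps ts)) (code p (length ts) (exps ts))
     (pts p (length ts') (exps ts')) (code p (length ts') (exps ts'))"

lemma code_equiv_GH_iff:
  assumes p: "p > 0" and ts: "admissible ts" "tval ts = t" and ts': "admissible ts'" "tval ts' = t"
  shows "code_equiv p (p ^ t) (GH p ts) (GH p ts') \<longleftrightarrow> exps_equiv p ts ts'"
proof -
  have "code_equiv p (p ^ t) (GH p ts) (GH p ts')
      \<longleftrightarrow> cequiv p {..<p ^ t} (nth ` GH p ts) {..<p ^ t} (nth ` GH p ts')"
    by (rule code_equiv_iff_cequiv[OF p]) (use GH_words[OF p] ts ts' in auto)
  also have "\<dots> \<longleftrightarrow> exps_equiv p ts ts'"
    unfolding exps_equiv_def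
    using cequiv_trans[OF cequiv_GH[OF p ts(1), unfolded ts(2)]]
      cequiv_trans[OF cequiv_sym[OF p cequiv_GH[OF p ts(1), unfolded ts(2)]]]
      cequiv_trans[OF _ cequiv_GH[OF p ts'(1), unfolded ts'(2)]]
      cequiv_trans[OF _ cequiv_sym[OF p cequiv_GH[OF p ts'(1), unfolded ts'(2)]]]
    by meson
  finally show ?thesis .
qed

lemma exps_equiv_refl: "exps_equiv p ts ts"
  by (simp add: exps_equiv_def cequiv_refl)

lemma exps_equiv_sym: "p > 0 \<Longrightarrow> exps_equiv p ts ts' \<Longrightarrow> exps_equiv p ts' ts"
  unfolding exps_equiv_def by (rule cequiv_sym)

lemma exps_equiv_trans: "exps_equiv p ts ts' \<Longrightarrow> exps_equiv p ts' ts'' \<Longrightarrow> exps_equiv p ts ts''"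
  unfolding exps_equiv_def by (rule cequiv_trans)

lemma count_list_replicate: "count_list (replicate n x) y = (if x = y then n else 0)"
  by (induction n) auto

lemma count_list_exps:
  assumes "i < length ts"
  shows "count_list (exps ts) (length ts - i) = ts ! i - (if i = 0 then 1 else 0)"
proof -
  let ?s = "length ts"
  have "count_list (concat (map (\<lambda>k. replicate (ts ! k) (?s - k)) [1..<?s])) (?s - i)
      = (\<Sum>k\<in>{1..<?s}. if ?s - k = ?s - i then ts ! k else 0)"
    by (simp add: count_list_concat comp_def count_list_replicate interv_sum_list_conv_sum_set_nat)
  also have "\<dots> = (\<Sum>k\<in>{1..<?s}. if k = i then ts ! k else 0)"
    using assms by (intro sum.cong) auto
  also have "\<dots> = (if i = 0 then 0 else ts ! i)"
    using assms by auto
  finally show ?thesis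
    using assms by (auto simp: exps_def count_list_replicate)
qed

lemma nondegenerate_exps:
  assumes "admissible ts" "length ts = 1 \<or> ts ! 0 \<ge> 2"
  shows "nondegenerate (length ts) (exps ts)"
  using assms exps_le by (auto simp: nondegenerate_def admissible_def exps_def)

text \<open>The multiplicities of the positive exponents are the entries of the type, except that
  the first is lowered by one; admissibility makes this truncated subtraction reversible.\<close>

lemma exps_equiv_imp_eq:
  assumes p: "prime p" "p \<ge> 3"
    and ts: "admissible ts" "length ts = 1 \<or> ts ! 0 \<ge> 2"
    and ts': "admissible ts'" "length ts' = 1 \<or> ts' ! 0 \<ge> 2"
    and e: "exps_equiv p ts ts'"
  shows "ts = ts'"
proof (rule nth_equalityI)
  have *: "length ts = length ts'" "\<And>j. j \<ge> 1 \<Longrightarrow> count_list (exps ts) j = count_list (exps ts') j"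
    using cequiv_code_imp_eq[OF p nondegenerate_exps[OF ts] nondegenerate_exps[OF ts'] e[unfolded exps_equiv_def]]
    by auto
  then show "length ts = length ts'" by simp
  fix i assume i: "i < length ts"
  have "ts ! i - (if i = 0 then 1 else 0) = ts' ! i - (if i = 0 then 1 else 0)"
    using *(2)[of "length ts - i"] count_list_exps[of i ts] count_list_exps[of i ts'] i *(1) by simp
  then show "ts ! i = ts' ! i"
    using ts(1) ts'(1) by (cases "i = 0") (auto simp: admissible_def)
qed

text \<open>The extra row of order \<open>p\<close> joins the last entry of \<open>r\<close>, and
  the first entry grows by one because \<open>exps\<close> subtracts the row of ones there. If
  \<open>r\<close> has a single entry, both increments fall on it, hence the nested update.\<close>

lemma exps_snoc_1:
  assumes r: "r \<noteq> []" and m: "m = length r - 1"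
  shows "exps (r[0 := Suc (r ! 0), m := Suc (r[0 := Suc (r ! 0)] ! m)]) = exps (1 # r) @ [1]"
proof -
  let ?r = "r[0 := Suc (r ! 0), m := Suc (r[0 := Suc (r ! 0)] ! m)]"
  have len: "length r = Suc m" using r m by (cases r) auto
  have "exps (1 # r) = concat (map (\<lambda>i. replicate ((1 # r) ! i) (Suc (Suc m) - i)) (map Suc [0..<Suc m]))"
    by (simp add: exps_def len map_Suc_upt del: upt_Suc)
  also have "\<dots> = concat (map (\<lambda>i. replicate (r ! i) (Suc m - i)) (0 # [1..<Suc m]))"
    by (simp add: comp_def upt_conv_Cons del: upt_Suc)
  finally have 1: "exps (1 # r) = replicate (r ! 0) (Suc m)
      @ concat (map (\<lambda>i. replicate (r ! i) (Suc m - i)) [1..<Suc m])" by (simp del: upt_Suc)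
  show ?thesis
  proof (cases "m = 0")
    case True
    then show ?thesis unfolding 1 using len by (simp add: exps_def replicate_append_same)
  next
    case False
    define r' where "r' = ?r"
    have r': "length r' = Suc m" "r' ! 0 = Suc (r ! 0)" "r' ! m = Suc (r ! m)"
      "\<And>i. 1 \<le> i \<Longrightarrow> i < m \<Longrightarrow> r' ! i = r ! i"
      using len False by (auto simp: r'_def)
    have u: "[1..<Suc m] = [1..<m] @ [m]" using False by simp
    have c: "map (\<lambda>i. replicate (r' ! i) (Suc m - i)) [1..<m] = map (\<lambda>i. replicate (r ! i) (Suc m - i)) [1..<m]"
      using r'(4) by simp
    have "exps r' = replicate (r ! 0) (Suc m)
        @ concat (map (\<lambda>i. replicate (r ! i) (Suc m - i)) [1..<m]) @ replicate (Suc (r ! m)) 1"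
      unfolding exps_def r'(1) u map_append concat_append c by (simp add: r'(2,3) del: replicate_Suc)
    then show ?thesis
      unfolding 1 u r'_def[symmetric] by (simp add: replicate_append_same)
  qed
qed

text \<open>While t_1 = 1 and the level is at least 2, \<open>cequiv_Suc\<close> together with
  \<open>exps_snoc_1\<close> shortens the type by one entry and keeps the length of the
  code.\<close>

lemma exps_equiv_reduce:
  assumes p: "p > 0" and "admissible ts"
  shows "\<exists>ts'. admissible ts' \<and> tval ts' = tval ts \<and> (length ts' = 1 \<or> ts' ! 0 \<ge> 2) \<and> exps_equiv p ts ts'"
  using assms(2)
proof (induction "length ts" arbitrary: ts rule: less_induct)
  case less
  show ?case
  proof (cases "length ts = 1 \<or> ts ! 0 \<ge> 2")
    case True
    then show ?thesis using less.prems exps_equiv_refl by blast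
  next
    case False
    then have "ts ! 0 = 1" "length ts \<ge> 2" using less.prems by (auto simp: admissible_def)
    then have "ts = 1 # tl ts" "tl ts \<noteq> []" by (cases ts; auto)+
    then obtain r where ts: "ts = 1 # r" and r: "r \<noteq> []" by blast
    define m where "m = length r - 1"
    define r' where "r' = r[0 := Suc (r ! 0), m := Suc (r[0 := Suc (r ! 0)] ! m)]"
    have len: "length r' = length r" "length r = Suc m" using r by (simp_all add: r'_def m_def)
    have ad: "admissible r'" using len by (auto simp: admissible_def r'_def nth_list_update)
    have ex: "exps r' = exps ts @ [1]" unfolding r'_def ts by (rule exps_snoc_1[OF r m_def])
    have "\<forall>e\<in>set (exps ts). e \<le> Suc m" using len by (auto simp: exps_def ts)
    from cequiv_Suc[OF p _ this] have eq: "exps_equiv p ts r'"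
      unfolding exps_equiv_def ex using len by (simp add: ts)
    have tv: "tval r' = tval ts"
      unfolding tval_exps(2)[OF ad] tval_exps(2)[OF less.prems] ex using len by (simp add: ts)
    have "length r' < length ts" using len by (simp add: ts)
    from less.hyps[OF this ad] show ?thesis
      unfolding tv using exps_equiv_trans[OF eq] by blast
  qed
qed

text \<open>With all exponents equal to 1, \<open>cequiv_Suc\<close> applies at every level down to
  1, where the Gray map is the identity. This handles the linear type present at each level.\<close>

lemma cequiv_replicate_1:
  assumes p: "p > 0" and s: "s \<ge> 1"
  shows "cequiv p (pts p s (replicate n 1)) (code p s (replicate n 1))
    (pts p 1 (replicate (n + s - 1) 1)) (code p 1 (replicate (n + s - 1) 1))"
  using s
proof (induction s arbitrary: n rule: dec_induct)
  case base
  then show ?case by (simp add: cequiv_refl)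
next
  case (step s)
  have "cequiv p (pts p (Suc s) (replicate n 1)) (code p (Suc s) (replicate n 1))
    (pts p s (replicate n 1 @ [1])) (code p s (replicate n 1 @ [1]))"
    using step.hyps by (intro cequiv_Suc[OF p]) auto
  then show ?case
    using cequiv_trans step.IH[of "Suc n"] by (fastforce simp: replicate_append_same)
qed

section \<open>Counting\<close>

definition eqv :: "nat \<Rightarrow> nat \<Rightarrow> nat list set set \<Rightarrow> (nat list set \<times> nat list set) set" where
  "eqv p N S = {(C1, C2). C1 \<in> S \<and> C2 \<in> S \<and> code_equiv p N C1 C2}"

lemma eqv_GH:
  assumes p: "p > 0" and T: "\<And>ts. ts \<in> T \<Longrightarrow> admissible ts \<and> tval ts = t"
  shows "equiv (GH p ` T) (eqv p (p ^ t) (GH p ` T))"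
    and "\<lbrakk>ts \<in> T; ts' \<in> T\<rbrakk> \<Longrightarrow> (GH p ts, GH p ts') \<in> eqv p (p ^ t) (GH p ` T) \<longleftrightarrow> exps_equiv p ts ts'"
proof -
  let ?r = "eqv p (p ^ t) (GH p ` T)"
  have *: "(GH p ts, GH p ts') \<in> ?r \<longleftrightarrow> exps_equiv p ts ts'" if "ts \<in> T" "ts' \<in> T" for ts ts'
    using code_equiv_GH_iff[OF p] T that by (auto simp: eqv_def)
  then show "\<lbrakk>ts \<in> T; ts' \<in> T\<rbrakk> \<Longrightarrow> (GH p ts, GH p ts') \<in> ?r \<longleftrightarrow> exps_equiv p ts ts'" .
  show "equiv (GH p ` T) ?r"
  proof (rule equivI)
    show sub: "?r \<subseteq> GH p ` T \<times> GH p ` T" by (auto simp: eqv_def)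
    show "refl_on (GH p ` T) ?r"
      using * exps_equiv_refl by (auto simp: refl_on_def)
    show "sym ?r"
    proof (rule symI)
      fix C D assume CD: "(C, D) \<in> ?r"
      then obtain ts ts' where "ts \<in> T" "ts' \<in> T" "C = GH p ts" "D = GH p ts'" using sub by blast
      then show "(D, C) \<in> ?r" using CD * exps_equiv_sym[OF p] by blast
    qed
    show "trans ?r"
    proof (rule transI)
      fix C D E assume CDE: "(C, D) \<in> ?r" "(D, E) \<in> ?r"
      then obtain ts ts' ts'' where "ts \<in> T" "ts' \<in> T" "ts'' \<in> T" "C = GH p ts" "D = GH p ts'" "E = GH p ts''"
        using sub by blast
      then show "(C, E) \<in> ?r" using CDE * exps_equiv_trans by blast
    qed
  qed
qed

lemma inj_on_GH_class:
  assumes p: "p > 0" and T: "\<And>ts. ts \<in> T \<Longrightarrow> admissible ts \<and> tval ts = t" and B: "B \<subseteq> T"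
    and inj: "\<And>ts ts'. ts \<in> B \<Longrightarrow> ts' \<in> B \<Longrightarrow> exps_equiv p ts ts' \<Longrightarrow> ts = ts'"
  shows "inj_on (\<lambda>ts. eqv p (p ^ t) (GH p ` T) `` {GH p ts}) B"
proof (rule inj_onI)
  let ?r = "eqv p (p ^ t) (GH p ` T)"
  fix ts ts' assume ts: "ts \<in> B" "ts' \<in> B" and eq: "?r `` {GH p ts} = ?r `` {GH p ts'}"
  have "(GH p ts, GH p ts') \<in> ?r"
    using eq_equiv_class[OF eq eqv_GH(1)[OF p T]] ts B by auto
  then show "ts = ts'" using eqv_GH(2)[OF p T, of T ts ts'] ts B inj by auto
qed

section \<open>Counting types and equivalence classes\<close>

definition solutions :: "nat \<Rightarrow> nat \<Rightarrow> nat list set" where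
  "solutions t s = {ts. length ts = s \<and> t + 1 = (\<Sum>i<s. (s - i) * ts ! i) \<and> ts ! 0 \<ge> 1}"

lemma solutions_iff:
  assumes "s \<ge> 1"
  shows "ts \<in> solutions t s \<longleftrightarrow> admissible ts \<and> length ts = s \<and> tval ts = t"
  using assms tval_exps[of ts] by (auto simp: solutions_def admissible_def)

lemma finite_solutions: "finite (solutions t s)"
proof (rule finite_subset)
  show "solutions t s \<subseteq> {ts. set ts \<subseteq> {..t + 1} \<and> length ts = s}"
  proof
    fix ts assume "ts \<in> solutions t s"
    then have l: "length ts = s" and S: "t + 1 = (\<Sum>i<s. (s - i) * ts ! i)" by (auto simp: solutions_def)
    have "ts ! i \<le> t + 1" if "i < s" for i
    proof -
      have "1 * ts ! i \<le> (s - i) * ts ! i" using that by (intro mult_le_mono1) simp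
      also have "\<dots> \<le> (\<Sum>i<s. (s - i) * ts ! i)"
        using that by (intro member_le_sum) auto
      finally show ?thesis unfolding S by simp
    qed
    then show "ts \<in> {ts. set ts \<subseteq> {..t + 1} \<and> length ts = s}"
      using l by (auto simp: in_set_conv_nth)
  qed
qed (rule finite_lists_length_eq, simp)

lemma Xtilde_solutions: "Xtilde t s p = card {ts \<in> solutions t s. ts ! 0 \<ge> 2}"
  by (auto simp: Xtilde_def solutions_def intro!: arg_cong[where f = card])

text \<open>These types represent every class exactly once: existence is
  \<open>exps_equiv_reduce\<close>, uniqueness is \<open>exps_equiv_imp_eq\<close>.\<close>

lemma A_tp_eq_card:
  assumes p: "prime p" "p \<ge> 3"
  shows "A_tp t p = card {ts. admissible ts \<and> tval ts = t \<and> (length ts = 1 \<or> ts ! 0 \<ge> 2)}" (is "_ = card ?B")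
proof -
  let ?T = "{ts. admissible ts \<and> tval ts = t}"
  let ?r = "eqv p (p ^ t) (GH p ` ?T)"
  let ?cl = "\<lambda>ts. ?r `` {GH p ts}"
  have p0: "p > 0" using p(2) by simp
  have T: "admissible ts \<and> tval ts = t" if "ts \<in> ?T" for ts using that by simp
  have S: "GHcodes p t = GH p ` ?T" by (auto simp: GHcodes_def)
  have inj: "inj_on ?cl ?B"
    by (rule inj_on_GH_class[OF p0 T]) (use exps_equiv_imp_eq[OF p] in auto)
  have "(GH p ` ?T) // ?r = ?cl ` ?B"
  proof (intro subset_antisym subsetI)
    fix c assume "c \<in> (GH p ` ?T) // ?r"
    then obtain ts where ts: "ts \<in> ?T" "c = ?cl ts" by (auto elim!: quotientE)
    then obtain ts' where ts': "ts' \<in> ?B" "exps_equiv p ts ts'"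
      using exps_equiv_reduce[OF p0, of ts] by auto
    then have "(GH p ts, GH p ts') \<in> ?r" using eqv_GH(2)[OF p0 T ts(1), of ts'] by simp
    then have "c = ?cl ts'" using ts(2) equiv_class_eq[OF eqv_GH(1)[OF p0 T]] by blast
    then show "c \<in> ?cl ` ?B" using ts'(1) by blast
  next
    fix c assume "c \<in> ?cl ` ?B"
    then show "c \<in> (GH p ` ?T) // ?r" by (auto intro!: quotientI)
  qed
  then show ?thesis
    unfolding A_tp_def num_noneq_def S eqv_def[symmetric] using card_image[OF inj] by simp
qed

text \<open>The first summand alone is s t_1 \<ge> 2 s, which bounds the level by
  \<open>(t + 1) div 2\<close>; level 1 has only the type \<open>[t + 1]\<close>.\<close>

lemma representatives_eq:
  assumes "t \<ge> 3"
  shows "{ts. admissible ts \<and> tval ts = t \<and> (length ts = 1 \<or> ts ! 0 \<ge> 2)}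
    = insert [t + 1] (\<Union>s\<in>{2..(t + 1) div 2}. {ts \<in> solutions t s. ts ! 0 \<ge> 2})" (is "?B = ?U")
proof (intro subset_antisym subsetI)
  fix ts assume "ts \<in> ?B"
  then have ad: "admissible ts" and t: "tval ts = t" and c: "length ts = 1 \<or> ts ! 0 \<ge> 2" by auto
  show "ts \<in> ?U"
  proof (cases "length ts = 1")
    case True
    then obtain a where "ts = [a]" by (auto simp: length_Suc_conv)
    moreover from this have "a = t + 1" using t assms by (simp add: tval_def)
    ultimately show ?thesis by simp
  next
    case False
    have l: "length ts \<ge> 1" using ad by (simp add: admissible_def)
    have sol: "ts \<in> solutions t (length ts)" using solutions_iff[OF l] ad t by simp
    have "length ts * 2 \<le> (length ts - 0) * ts ! 0" using c False by simp
    also have "\<dots> \<le> (\<Sum>i<length ts. (length ts - i) * ts ! i)"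
      using l by (intro member_le_sum) auto
    also have "\<dots> = t + 1" using sol by (simp add: solutions_def)
    finally have "length ts \<in> {2..(t + 1) div 2}" using l False by auto
    then show ?thesis using sol c False by auto
  qed
next
  fix ts assume "ts \<in> ?U"
  then show "ts \<in> ?B"
    using solutions_iff by (auto simp: admissible_def tval_def)
qed

lemma A_tp_eq:
  assumes p: "prime p" "p \<ge> 3" and t: "t \<ge> 3"
  shows "A_tp t p = 1 + (\<Sum>s = 2..(t + 1) div 2. Xtilde t s p)"
proof -
  let ?X = "\<lambda>s. {ts \<in> solutions t s. ts ! 0 \<ge> 2}"
  have fin: "finite (?X s)" for s using finite_solutions by simp
  have len: "length ts = s" if "ts \<in> ?X s" for ts s using that by (simp add: solutions_def)
  have "[t + 1] \<notin> (\<Union>s\<in>{2..(t + 1) div 2}. ?X s)" using len by fastforce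
  then have "A_tp t p = 1 + card (\<Union>s\<in>{2..(t + 1) div 2}. ?X s)"
    unfolding A_tp_eq_card[OF p] representatives_eq[OF t] using fin by simp
  also have "card (\<Union>s\<in>{2..(t + 1) div 2}. ?X s) = (\<Sum>s = 2..(t + 1) div 2. card (?X s))"
    using fin len by (intro card_UN_disjoint) blast+
  finally show ?thesis by (simp add: Xtilde_solutions)
qed

text \<open>The additional class is that of \<open>?lin\<close>, all of whose rows but the row of
  ones have exponent 1. It is equivalent to the type \<open>[t + 1]\<close> of level 1, hence to no
  type of level \<open>s \<ge> 2\<close> with t_1 \<ge> 2.\<close>

lemma A_tsp_ge:
  assumes p: "prime p" "p \<ge> 3" and s: "2 \<le> s" "s \<le> t + 1"
  shows "Xtilde t s p + 1 \<le> A_tsp t s p"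
proof -
  let ?T = "solutions t s" and ?X = "{ts \<in> solutions t s. ts ! 0 \<ge> 2}"
  let ?r = "eqv p (p ^ t) (GH p ` ?T)"
  let ?cl = "\<lambda>ts. ?r `` {GH p ts}"
  \<comment> \<open>The weighted sum of this type is \<open>s + (t + 1 - s) = t + 1\<close>, where
    \<open>s \<le> t + 1\<close> prevents truncation.\<close>
  let ?lin = "1 # replicate (s - 2) 0 @ [t + 1 - s]"
  have p0: "p > 0" using p(2) by simp
  have T: "admissible ts \<and> tval ts = t" if "ts \<in> ?T" for ts
    using solutions_iff[of s ts t] that s by simp
  have S: "GHcodes_s p t s = GH p ` ?T"
    using solutions_iff[of s _ t] s by (auto simp: GHcodes_s_def)
  have len: "length ?lin = s" using s by simp
  have "exps ?lin = concat (map (\<lambda>i. replicate (?lin ! i) (s - i)) ([1..<s - 1] @ [s - 1]))"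
  proof -
    have "[1..<s] = [1..<s - 1] @ [s - 1]" using s upt_Suc_append[of 1 "s - 1"] by simp
    then show ?thesis
      unfolding exps_def len by (simp only: nth_Cons_0 diff_self_eq_0 replicate_0 append_Nil)
  qed
  also have "\<dots> = replicate (t + 1 - s) 1"
    using s by (auto simp: nth_append nth_Cons')
  finally have ex: "exps ?lin = replicate (t + 1 - s) 1" .
  have adl: "admissible ?lin" using s by (simp add: admissible_def)
  have "tval ?lin = t" unfolding tval_exps(2)[OF adl] ex len using s by (simp add: sum_list_replicate)
  then have linT: "?lin \<in> ?T" using solutions_iff[of s ?lin t] adl len s by simp
  have "exps [t + 1] = replicate t 1" by (simp add: exps_def)
  then have lin: "exps_equiv p ?lin [t + 1]"
    using cequiv_replicate_1[OF p0, of s "t + 1 - s"] s unfolding exps_equiv_def ex len by simp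
  have X: "admissible ts" "length ts = s" "length ts = 1 \<or> ts ! 0 \<ge> 2" if "ts \<in> ?X" for ts
    using that T[of ts] by (auto simp: solutions_def)
  have no: "\<not> exps_equiv p ?lin ts" if "ts \<in> ?X" for ts
  proof
    assume "exps_equiv p ?lin ts"
    then have "exps_equiv p [t + 1] ts" using lin exps_equiv_sym[OF p0] exps_equiv_trans by blast
    then have "[t + 1] = ts"
      using X[OF that] by (intro exps_equiv_imp_eq[OF p]) (auto simp: admissible_def)
    then show False using X(2)[OF that] s by auto
  qed
  have "inj_on ?cl (insert ?lin ?X)"
  proof (rule inj_on_GH_class[OF p0 T])
    show "insert ?lin ?X \<subseteq> ?T" using linT by auto
    fix ts ts' assume "ts \<in> insert ?lin ?X" "ts' \<in> insert ?lin ?X" "exps_equiv p ts ts'"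
    then consider "ts = ?lin" "ts' = ?lin" | "ts = ?lin" "ts' \<in> ?X" "exps_equiv p ?lin ts'"
      | "ts \<in> ?X" "ts' = ?lin" "exps_equiv p ts ?lin" | "ts \<in> ?X" "ts' \<in> ?X" "exps_equiv p ts ts'"
      by blast
    then show "ts = ts'"
    proof cases
      case 2
      then show ?thesis using no by blast
    next
      case 3
      then show ?thesis using no exps_equiv_sym[OF p0] by blast
    next
      case 4
      then show ?thesis using exps_equiv_imp_eq[OF p X(1,3) X(1,3)] by blast
    qed simp
  qed
  moreover have "?cl ` insert ?lin ?X \<subseteq> (GH p ` ?T) // ?r"
    using linT by (auto intro!: quotientI)
  moreover have "finite ((GH p ` ?T) // ?r)"
    by (rule finite_quotient) (use finite_solutions in \<open>auto simp: eqv_def\<close>)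
  ultimately have "card (insert ?lin ?X) \<le> card ((GH p ` ?T) // ?r)"
    by (rule card_inj_on_le)
  moreover have "?lin \<notin> ?X" by simp
  ultimately have "Suc (card ?X) \<le> card ((GH p ` ?T) // ?r)"
    using finite_solutions[of t s] by simp
  then show ?thesis
    unfolding A_tsp_def num_noneq_def S Xtilde_solutions eqv_def[symmetric] by simp
qed

text \<open>All claims are read off the equality \<open>A_tp_eq\<close>. The second also compares
  summands by \<open>A_tsp_ge\<close>; integers keep the subtraction of 1 from truncating.\<close>

theorem theorem5:
  fixes p t :: nat
  assumes "prime p" and "p \<ge> 3" and "t \<ge> 3"
  shows "A_tp t p \<le> 1 + (\<Sum>s = 2..(t + 1) div 2. Xtilde t s p)
     \<and> int (A_tp t p) \<le> 1 + (\<Sum>s = 2..(t + 1) div 2. int (A_tsp t s p) - 1)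
     \<and> (t \<le> 10 \<longrightarrow> A_tp t p = 1 + (\<Sum>s = 2..(t + 1) div 2. Xtilde t s p))"
proof -
  have eq: "A_tp t p = 1 + (\<Sum>s = 2..(t + 1) div 2. Xtilde t s p)" by (rule A_tp_eq[OF assms])
  have "int (Xtilde t s p) \<le> int (A_tsp t s p) - 1" if "s \<in> {2..(t + 1) div 2}" for s
  proof -
    have "2 \<le> s" "s \<le> t + 1" using that by (auto intro: le_trans[OF _ div_le_dividend])
    then show ?thesis using A_tsp_ge[OF assms(1,2), of s t] by simp
  qed
  then have "(\<Sum>s = 2..(t + 1) div 2. int (Xtilde t s p)) \<le> (\<Sum>s = 2..(t + 1) div 2. int (A_tsp t s p) - 1)"
    by (rule sum_mono)
  then show ?thesis using eq by simp
qed

end
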